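(* Let $G$ be a $\sigma$-compact locally compact Abelian group and $\Lambda\subset G$ an almost lattice. Then $\Lambda$ is a subset of a model set.
   Context: $\Lambda$ is an almost lattice if it is relatively dense, locally finite, and there is a finite set $F$ with $\Lambda-\Lambda\subset\Lambda+F$. A cut and project scheme $(G\times H,\widetilde L)$: $H$ a locally compact Abelian group, $\widetilde L\subset G\times H$ a discrete cocompact subgroup with $\pi_1|_{\widetilde L}$ injective and $\pi_2(\widetilde L)$ dense; $x^\star:=\pi_2((\pi_1|_{\widetilde L})^{-1}(x))$. A model set is $\Lambda(W):=\{x\in\pi_1(\widetilde L):x^\star\in W\}$ with $W\subset H$ precompact with nonempty interior. *)

theory Defs
  imports "HOL-Analysis.Analysis"
begin

definition sigma_compact_group :: "'a::topological_space itself \<Rightarrow> bool" where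
  "sigma_compact_group _ \<longleftrightarrow>
     (\<exists>K :: nat \<Rightarrow> 'a set. (\<forall>n. compact (K n)) \<and> (\<Union>n. K n) = UNIV)"

definition relatively_dense :: "'a::{topological_space, ab_group_add} set \<Rightarrow> bool" where
  "relatively_dense \<Lambda> \<longleftrightarrow> (\<exists>K. compact K \<and> {x + k | x k. x \<in> \<Lambda> \<and> k \<in> K} = UNIV)"

definition locally_finite_set :: "'a::topological_space set \<Rightarrow> bool" where
  "locally_finite_set \<Lambda> \<longleftrightarrow> (\<forall>K. compact K \<longrightarrow> finite (\<Lambda> \<inter> K))"

definition almost_lattice :: "'a::{topological_space, ab_group_add} set \<Rightarrow> bool" where
  "almost_lattice \<Lambda> \<longleftrightarrow> relatively_dense \<Lambda> \<and> locally_finite_set \<Lambda> \<and>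
     (\<exists>F. finite F \<and> {x - y | x y. x \<in> \<Lambda> \<and> y \<in> \<Lambda>} \<subseteq> {x + f | x f. x \<in> \<Lambda> \<and> f \<in> F})"

definition lca_group :: "'h topology \<Rightarrow> ('h \<Rightarrow> 'h \<Rightarrow> 'h) \<Rightarrow> 'h \<Rightarrow> ('h \<Rightarrow> 'h) \<Rightarrow> bool" where
  "lca_group T add zero neg \<longleftrightarrow>
     zero \<in> topspace T \<and>
     (\<forall>x\<in>topspace T. \<forall>y\<in>topspace T. add x y \<in> topspace T) \<and>
     (\<forall>x\<in>topspace T. neg x \<in> topspace T) \<and>
     (\<forall>x\<in>topspace T. \<forall>y\<in>topspace T. \<forall>z\<in>topspace T. add (add x y) z = add x (add y z)) \<and>
     (\<forall>x\<in>topspace T. \<forall>y\<in>topspace T. add x y = add y x) \<and>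
     (\<forall>x\<in>topspace T. add zero x = x) \<and>
     (\<forall>x\<in>topspace T. add (neg x) x = zero) \<and>
     Hausdorff_space T \<and> locally_compact_space T \<and>
     continuous_map (prod_topology T T) T (\<lambda>(x, y). add x y) \<and>
     continuous_map T T neg"

text \<open>A cut and project scheme (G x H, L) with G the ambient type 'a and H the
  LCA group (T, add, zero, neg). Cocompactness of the discrete subgroup L is
  expressed by the existence of a compact K with K + L = G x H.\<close>

definition cut_and_project ::
  "'h topology \<Rightarrow> ('h \<Rightarrow> 'h \<Rightarrow> 'h) \<Rightarrow> 'h \<Rightarrow> ('h \<Rightarrow> 'h) \<Rightarrow>
   ('a::{topological_space, ab_group_add} \<times> 'h) set \<Rightarrow> bool" where
  "cut_and_project T add zero neg L \<longleftrightarrow>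
     lca_group T add zero neg \<and>
     L \<subseteq> UNIV \<times> topspace T \<and>
     (0, zero) \<in> L \<and>
     (\<forall>p\<in>L. \<forall>q\<in>L. (fst p + fst q, add (snd p) (snd q)) \<in> L) \<and>
     (\<forall>p\<in>L. (- fst p, neg (snd p)) \<in> L) \<and>
     subtopology (prod_topology euclidean T) L = discrete_topology L \<and>
     (\<exists>K. compactin (prod_topology euclidean T) K \<and>
          {(fst k + fst l, add (snd k) (snd l)) | k l. k \<in> K \<and> l \<in> L} = UNIV \<times> topspace T) \<and>
     inj_on fst L \<and>
     T closure_of (snd ` L) = topspace T"

definition star :: "('a \<times> 'h) set \<Rightarrow> 'a \<Rightarrow> 'h" where
  "star L x = snd (the_inv_into L fst x)"

definition model_set :: "('a \<times> 'h) set \<Rightarrow> 'h set \<Rightarrow> 'a set" where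
  "model_set L W = {x \<in> fst ` L. star L x \<in> W}"

definition admissible_window :: "'h topology \<Rightarrow> 'h set \<Rightarrow> bool" where
  "admissible_window T W \<longleftrightarrow>
     W \<subseteq> topspace T \<and> compactin T (T closure_of W) \<and> T interior_of W \<noteq> {}"

end

theory Submission
  imports Defs "HOL-Real_Asymp.Real_Asymp"
begin

text \<open>The difference set \<open>A = \<Lambda> - \<Lambda>\<close> is an approximate subgroup. Since finitely generated
  abelian groups have polynomial growth, the subsets of \<open>A + A + A + A\<close> carry a translation-invariant
  finitely additive probability, and the argument of Massicot and Wagner produces a
  symmetric \<open>S\<close>, finitely many translates of which cover \<open>A\<close>, whose eightfold sum lies in the
  fourfold sum of \<open>A\<close>. Iterating this gives a seminorm on \<open>G\<close> whose balls of radius less than \<open>1/2\<close>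
  are locally finite in \<open>G\<close> and totally bounded for the seminorm. The completion \<open>H\<close> of \<open>G\<close>
  for the seminorm is locally compact, and the graph of \<open>G \<rightarrow> H\<close> is the lattice of the required
  cut and project scheme.\<close>

section \<open>Invariant contents\<close>

text \<open>Two demands pull against each other: the image of \<Lambda> in \<open>H\<close> must be
  precompact, so the seminorm has to be coarse, and the graph must be discrete, so some ball has to
  be locally finite in \<open>G\<close>. Both hold if one ball lies in finitely many translates of
  \<open>A\<close> while finitely many translates of every ball cover \<open>A\<close>. The obstacle
  is that \<open>A\<close> comes with no smaller set of comparable size whose iterated sums stay
  under control, and measure is what produces one. An invariant mean on \<open>G\<close> would not
  do, as it may vanish on \<open>A\<close>. Hence the content is normalised on the fourfold sum
  \<open>U\<close> of \<open>A\<close>, and invariance is asked only of translations that stay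
  inside \<open>U\<close>. For the same reason near-invariance has to be counted inside
  \<open>U\<close>, and polynomial growth makes this possible. The map from \<open>G\<close> to
  \<open>H\<close> need not be continuous: the seminorm ignores the topology of \<open>G\<close>,
  and local finiteness of a ball is the only link between the two.\<close>

lemma power_eventually_exceeds_polynomial:
  fixes \<epsilon> :: real and k :: nat
  assumes "\<epsilon> > 0"
  shows "\<exists>n. real (Suc n) ^ k < (1 + \<epsilon>) ^ n"
proof -
  have "(\<lambda>n. real (Suc n) ^ k / (1 + \<epsilon>) ^ n) \<longlonglongrightarrow> 0"
    using assms by real_asymp
  then have "eventually (\<lambda>n. real (Suc n) ^ k / (1 + \<epsilon>) ^ n < 1) sequentially"
    by (rule order_tendstoD) simp
  then obtain n where "real (Suc n) ^ k / (1 + \<epsilon>) ^ n < 1"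
    by (auto simp: eventually_sequentially)
  then have "real (Suc n) ^ k < (1 + \<epsilon>) ^ n"
    using assms by (simp add: divide_simps del: of_nat_Suc split: if_splits)
  then show ?thesis ..
qed

text \<open>\<open>Q n\<close> is the box of sums using each negative \<open>- e\<close> at most
  \<open>n\<close> times, so a shift by \<open>- e\<close> stays in \<open>Q (Suc n)\<close>. If the
  count of \<open>U \<inter> Q n\<close> always grew by a factor above
  \<open>1 + \<epsilon>\<close>, it would be exponential in \<open>n\<close>, whereas the whole box
  has at most \<open>Suc n ^ card P\<close> points. It starts from at least 1 because
  \<open>0\<close> lies in \<open>U\<close>.\<close>

lemma folner_set_exists:
  fixes U E :: "'a::ab_group_add set" and \<epsilon> :: real
  assumes "0 \<in> U" "finite E" "\<epsilon> > 0"
  obtains Q where "finite Q" "U \<inter> Q \<noteq> {}"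
    "\<And>e. e \<in> E \<Longrightarrow> real (card (U \<inter> ((+) (- e) ` Q - Q))) \<le> \<epsilon> * real (card (U \<inter> Q))"
proof -
  define P where "P = uminus ` E"
  have finP: "finite P" using assms by (simp add: P_def)
  \<comment> \<open>The inner sum is the multiple \<open>c p\<close> times \<open>p\<close>, so
    \<open>c\<close> lists multiplicities of the generators.\<close>
  define v where "v c = (\<Sum>p\<in>P. \<Sum>i<c p. p)" for c :: "'a \<Rightarrow> nat"
  define Q where "Q n = v ` (PiE P (\<lambda>_. {..n}))" for n :: nat
  define a where "a n = card (U \<inter> Q n)" for n
  have finPi: "finite (PiE P (\<lambda>_. {..n}))" for n :: nat
    using finP by (intro finite_PiE) auto
  then have finQ: "finite (Q n)" for n by (simp add: Q_def)
  have cardQ: "card (Q n) \<le> Suc n ^ card P" for n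
  proof -
    have "card (Q n) \<le> card (PiE P (\<lambda>_. {..n}))"
      unfolding Q_def by (intro card_image_le finPi)
    also have "\<dots> = Suc n ^ card P"
      using finP by (simp add: card_PiE)
    finally show ?thesis .
  qed
  have mono: "Q n \<subseteq> Q (Suc n)" for n
    unfolding Q_def by (intro image_mono PiE_mono) auto
  have shift: "(+) p ` Q n \<subseteq> Q (Suc n)" if "p \<in> P" for p n
  proof clarify
    fix x assume "x \<in> Q n"
    then obtain c where c: "c \<in> PiE P (\<lambda>_. {..n})" "x = v c" by (auto simp: Q_def)
    define c' where "c' = c(p := Suc (c p))"
    have "c' \<in> PiE P (\<lambda>_. {..Suc n})"
      using c(1) that by (auto simp: c'_def PiE_iff extensional_def le_SucI)
    moreover have "v c' = p + v c"
      unfolding v_def using that finP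
      by (simp add: sum.remove[of P p] c'_def add.assoc add.left_commute cong: sum.cong_simp)
    ultimately show "p + x \<in> Q (Suc n)"
      unfolding Q_def using c(2) by (intro image_eqI[of _ v c']) simp_all
  qed
  have zero: "0 \<in> Q n" for n
    unfolding Q_def by (intro image_eqI[of _ _ "\<lambda>x\<in>P. 0"]) (auto simp: v_def)
  have a_pos: "a n \<ge> 1" for n
    using zero[of n] assms(1) finQ[of n] by (auto simp: a_def Suc_le_eq card_gt_0_iff)
  have "\<exists>n. real (a (Suc n)) \<le> (1 + \<epsilon>) * real (a n)"
  proof (rule ccontr)
    assume "\<not> ?thesis"
    then have step: "real (a (Suc n)) > (1 + \<epsilon>) * real (a n)" for n
      by (simp add: not_le)
    have grow: "(1 + \<epsilon>) ^ n \<le> real (a n)" for n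
    proof (induction n)
      case 0 show ?case using a_pos[of 0] by simp
    next
      case (Suc n)
      have "(1 + \<epsilon>) * (1 + \<epsilon>) ^ n \<le> (1 + \<epsilon>) * real (a n)"
        using Suc assms(3) by (intro mult_left_mono) auto
      then show ?case using step[of n] by simp
    qed
    obtain n where n: "real (Suc n) ^ card P < (1 + \<epsilon>) ^ n"
      using power_eventually_exceeds_polynomial[OF assms(3)] by blast
    have "a n \<le> Suc n ^ card P"
      unfolding a_def using cardQ[of n] card_mono[OF finQ, of "U \<inter> Q n" n] by (meson Int_lower2 le_trans)
    then have "real (a n) \<le> real (Suc n ^ card P)" by (rule of_nat_mono)
    then show False using grow[of n] n by simp
  qed
  then obtain n where n: "real (a (Suc n)) \<le> (1 + \<epsilon>) * real (a n)" ..
  show thesis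
  proof
    show "finite (Q n)" by (rule finQ)
    show "U \<inter> Q n \<noteq> {}" using zero assms by blast
    fix e assume "e \<in> E"
    then have "(+) (- e) ` Q n \<subseteq> Q (Suc n)" by (intro shift) (simp add: P_def)
    then have "card (U \<inter> ((+) (- e) ` Q n - Q n)) \<le> card (U \<inter> Q (Suc n) - U \<inter> Q n)"
      using finQ by (intro card_mono) auto
    also have "\<dots> = a (Suc n) - a n"
      unfolding a_def using mono[of n] finQ by (intro card_Diff_subset) auto
    finally have le: "card (U \<inter> ((+) (- e) ` Q n - Q n)) \<le> a (Suc n) - a n" .
    have "a n \<le> a (Suc n)"
      unfolding a_def using mono[of n] finQ by (intro card_mono) auto
    then have "real (card (U \<inter> ((+) (- e) ` Q n - Q n))) \<le> real (a (Suc n)) - real (a n)"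
      using le by linarith
    then show "real (card (U \<inter> ((+) (- e) ` Q n - Q n))) \<le> \<epsilon> * real (card (U \<inter> Q n))"
      using n by (simp add: a_def algebra_simps)
  qed
qed

text \<open>A finitely additive probability on the subsets of \<open>U\<close>. It is a total
  function on all sets, so that such contents form a subset of a product of real lines, where
  compactness can be applied.\<close>

definition content_on :: "'a::ab_group_add set \<Rightarrow> ('a set \<Rightarrow> real) \<Rightarrow> bool" where
  "content_on U \<mu> \<longleftrightarrow> \<mu> U = 1 \<and> (\<forall>X. 0 \<le> \<mu> X) \<and>
     (\<forall>X Y. X \<subseteq> U \<longrightarrow> Y \<subseteq> U \<longrightarrow> X \<inter> Y = {} \<longrightarrow> \<mu> (X \<union> Y) = \<mu> X + \<mu> Y)"

text \<open>Normalised counting measure on \<open>U \<inter> Q\<close> for a Folner set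
  \<open>Q\<close>. A point of the translate of \<open>X\<close> by \<open>e\<close> that lies in
  \<open>Q\<close> comes from a point of \<open>X\<close> that is either in \<open>Q\<close> or in
  the part of \<open>Q - e\<close> outside \<open>Q\<close>, and the latter are few. The one-sided
  bound suffices, since in the limit it is also applied to \<open>- e\<close>.\<close>

lemma almost_invariant_content_exists:
  fixes U E :: "'a::ab_group_add set" and \<epsilon> :: real
  assumes "0 \<in> U" "finite E" "\<epsilon> > 0"
  obtains \<mu> where "content_on U \<mu>" "\<And>X. \<mu> X \<le> 1"
    "\<And>X e. e \<in> E \<Longrightarrow> X \<subseteq> U \<Longrightarrow> (+) e ` X \<subseteq> U \<Longrightarrow> \<mu> ((+) e ` X) \<le> \<mu> X + \<epsilon>"
proof -
  obtain Q where Q: "finite Q" "U \<inter> Q \<noteq> {}"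
    "\<And>e. e \<in> E \<Longrightarrow> real (card (U \<inter> ((+) (- e) ` Q - Q))) \<le> \<epsilon> * real (card (U \<inter> Q))"
    using folner_set_exists[OF assms] by blast
  define N where "N = real (card (U \<inter> Q))"
  have N: "N > 0" using Q by (simp add: N_def card_gt_0_iff)
  define \<mu> where "\<mu> X = real (card (X \<inter> U \<inter> Q)) / N" for X
  show thesis
  proof
    show "content_on U \<mu>"
      unfolding content_on_def
    proof (intro conjI allI impI)
      show "\<mu> U = 1" using N by (simp add: \<mu>_def N_def)
      show "0 \<le> \<mu> X" for X using N by (simp add: \<mu>_def)
      fix X Y :: "'a set" assume "X \<subseteq> U" "Y \<subseteq> U" and d: "X \<inter> Y = {}"
      have "card ((X \<inter> U \<inter> Q) \<union> (Y \<inter> U \<inter> Q)) = card (X \<inter> U \<inter> Q) + card (Y \<inter> U \<inter> Q)"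
        using Q d by (intro card_Un_disjoint) auto
      moreover have "(X \<inter> U \<inter> Q) \<union> (Y \<inter> U \<inter> Q) = (X \<union> Y) \<inter> U \<inter> Q" by auto
      ultimately show "\<mu> (X \<union> Y) = \<mu> X + \<mu> Y"
        by (simp add: \<mu>_def add_divide_distrib)
    qed
    show "\<mu> X \<le> 1" for X
    proof -
      have "card (X \<inter> U \<inter> Q) \<le> card (U \<inter> Q)" using Q by (intro card_mono) auto
      then show ?thesis using N by (simp add: \<mu>_def N_def divide_simps)
    qed
    fix X e assume e: "e \<in> E" and X: "X \<subseteq> U" "(+) e ` X \<subseteq> U"
    have "(+) e ` X \<inter> U \<inter> Q \<subseteq> (+) e ` ((X \<inter> U \<inter> Q) \<union> (U \<inter> ((+) (- e) ` Q - Q)))"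
    proof
      fix y assume y: "y \<in> (+) e ` X \<inter> U \<inter> Q"
      then obtain x where x: "x \<in> X" "y = e + x" by blast
      have "x = - e + y" by (simp add: x)
      then have "x \<in> (+) (- e) ` Q" using y by blast
      then show "y \<in> (+) e ` ((X \<inter> U \<inter> Q) \<union> (U \<inter> ((+) (- e) ` Q - Q)))"
        using x X y by blast
    qed
    then have "card ((+) e ` X \<inter> U \<inter> Q) \<le> card ((+) e ` ((X \<inter> U \<inter> Q) \<union> (U \<inter> ((+) (- e) ` Q - Q))))"
      using Q by (intro card_mono) auto
    also have "\<dots> \<le> card ((X \<inter> U \<inter> Q) \<union> (U \<inter> ((+) (- e) ` Q - Q)))"
      using Q by (intro card_image_le) auto
    also have "\<dots> \<le> card (X \<inter> U \<inter> Q) + card (U \<inter> ((+) (- e) ` Q - Q))"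
      by (rule card_Un_le)
    finally have "real (card ((+) e ` X \<inter> U \<inter> Q)) \<le> real (card (X \<inter> U \<inter> Q)) + \<epsilon> * N"
      using Q(3)[OF e] by (simp add: N_def)
    then show "\<mu> ((+) e ` X) \<le> \<mu> X + \<epsilon>"
      using N by (simp add: \<mu>_def divide_simps)
  qed
qed

text \<open>Compactness of the cube of functions into \<open>{0..1}\<close> by Tychonoff: the
  conditions \<open>C (e, \<epsilon>)\<close> are closed, and any finitely many of them hold
  together by the almost invariant case.\<close>

lemma invariant_content_exists:
  fixes U :: "'a::ab_group_add set"
  assumes "0 \<in> U"
  obtains \<mu> where "content_on U \<mu>"
    "\<And>X e. X \<subseteq> U \<Longrightarrow> (+) e ` X \<subseteq> U \<Longrightarrow> \<mu> ((+) e ` X) = \<mu> X"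
proof -
  define K where "K = (PiE UNIV (\<lambda>_. {0..1}) :: ('a set \<Rightarrow> real) set)"
  have "compactin (product_topology (\<lambda>_. euclidean) UNIV) K"
    unfolding K_def compactin_PiE by simp
  then have "compact K"
    by (simp add: euclidean_product_topology)
  define C where "C p = {\<mu>. content_on U \<mu> \<and> (\<forall>X. X \<subseteq> U \<longrightarrow> (+) (fst p) ` X \<subseteq> U \<longrightarrow>
       \<mu> ((+) (fst p) ` X) \<le> \<mu> X + snd p)}" for p :: "'a \<times> real"
  have closedC: "closed (C p)" for p
  proof -
    have "C p = {\<mu>. \<mu> U = 1} \<inter> (\<Inter>X. {\<mu>. 0 \<le> \<mu> X}) \<inter>
        (\<Inter>X\<in>Pow U. \<Inter>Y\<in>{Y. Y \<subseteq> U \<and> X \<inter> Y = {}}. {\<mu>. \<mu> (X \<union> Y) = \<mu> X + \<mu> Y}) \<inter>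
        (\<Inter>X\<in>{X. X \<subseteq> U \<and> (+) (fst p) ` X \<subseteq> U}. {\<mu>. \<mu> ((+) (fst p) ` X) \<le> \<mu> X + snd p})"
      by (auto simp: C_def content_on_def)
    also have "closed \<dots>"
      by (intro closed_Int closed_INT ballI closed_Collect_eq closed_Collect_le
          continuous_intros continuous_on_product_coordinates)
    finally show ?thesis .
  qed
  have fip: "K \<inter> \<Inter>F' \<noteq> {}" if F': "finite F'" "F' \<subseteq> C ` (UNIV \<times> {0<..})" for F'
  proof -
    obtain I where I: "finite I" "I \<subseteq> UNIV \<times> {0<..}" "F' = C ` I"
      using finite_subset_image[OF F'] by blast
    \<comment> \<open>The extra element 1 keeps the minimum meaningful and positive when
      \<open>I\<close> is empty.\<close>
    define \<epsilon> where "\<epsilon> = Min (insert 1 (snd ` I))"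
    have \<epsilon>: "\<epsilon> > 0" "\<And>p. p \<in> I \<Longrightarrow> \<epsilon> \<le> snd p"
      using I by (auto simp: \<epsilon>_def)
    obtain \<mu> where \<mu>: "content_on U \<mu>" "\<And>X. \<mu> X \<le> 1"
      "\<And>X e. e \<in> fst ` I \<Longrightarrow> X \<subseteq> U \<Longrightarrow> (+) e ` X \<subseteq> U \<Longrightarrow> \<mu> ((+) e ` X) \<le> \<mu> X + \<epsilon>"
      by (rule almost_invariant_content_exists[OF assms finite_imageI[OF I(1)] \<epsilon>(1), of fst]) blast
    have "\<mu> \<in> K" using \<mu> by (auto simp: K_def content_on_def)
    moreover have "\<mu> \<in> C p" if "p \<in> I" for p
      using \<mu> \<epsilon>(2)[OF that] that unfolding C_def by (smt (verit) image_eqI mem_Collect_eq)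
    ultimately show ?thesis using I by auto
  qed
  have "K \<inter> \<Inter>(C ` (UNIV \<times> {0<..})) \<noteq> {}"
  proof (rule compact_imp_fip[OF \<open>compact K\<close>])
    show "closed T" if "T \<in> C ` (UNIV \<times> {0<..})" for T
      using that closedC by blast
  qed (rule fip)
  then obtain \<mu> where \<mu>: "\<And>e \<epsilon>. \<epsilon> > 0 \<Longrightarrow> \<mu> \<in> C (e, \<epsilon>)" by blast
  have le: "\<mu> ((+) e ` X) \<le> \<mu> X" if "X \<subseteq> U" "(+) e ` X \<subseteq> U" for X e
  proof (rule field_le_epsilon)
    fix \<epsilon> :: real assume "\<epsilon> > 0"
    from \<mu>[OF this, of e] show "\<mu> ((+) e ` X) \<le> \<mu> X + \<epsilon>"
      using that by (simp add: C_def)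
  qed
  show thesis
  proof
    show "content_on U \<mu>" using \<mu>[of 1 0] by (simp add: C_def)
    fix X e assume X: "X \<subseteq> U" "(+) e ` X \<subseteq> U"
    have "(+) (- e) ` (+) e ` X = X" by (simp add: image_image)
    then show "\<mu> ((+) e ` X) = \<mu> X"
      using le[of X e] le[of "(+) e ` X" "- e"] X by simp
  qed
qed

section \<open>Approximate subgroups\<close>

definition approximate_subgroup :: "'a::ab_group_add set \<Rightarrow> bool" where
  "approximate_subgroup A \<longleftrightarrow> 0 \<in> A \<and> (\<forall>x\<in>A. - x \<in> A) \<and> (\<exists>F. finite F \<and> A + A \<subseteq> A + F)"

section \<open>Calculus of finitely additive contents\<close>

lemma content_on_basics:
  assumes "content_on U \<mu>"
  shows content_on_nonneg: "0 \<le> \<mu> X"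
    and content_on_full: "\<mu> U = 1"
    and content_on_Un_disjoint: "X \<subseteq> U \<Longrightarrow> Y \<subseteq> U \<Longrightarrow> X \<inter> Y = {} \<Longrightarrow> \<mu> (X \<union> Y) = \<mu> X + \<mu> Y"
  using assms by (auto simp: content_on_def)

lemma content_on_Diff:
  assumes "content_on U \<mu>" "X \<subseteq> U"
  shows "\<mu> (X - Y) = \<mu> X - \<mu> (X \<inter> Y)"
proof -
  have "\<mu> ((X - Y) \<union> (X \<inter> Y)) = \<mu> (X - Y) + \<mu> (X \<inter> Y)"
    using assms by (intro content_on_Un_disjoint) auto
  moreover have "(X - Y) \<union> (X \<inter> Y) = X" by blast
  ultimately show ?thesis by simp
qed

lemma content_on_mono:
  assumes "content_on U \<mu>" "X \<subseteq> Y" "Y \<subseteq> U"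
  shows "\<mu> X \<le> \<mu> Y"
  using content_on_Diff[OF assms(1,3), of X] content_on_nonneg[OF assms(1), of "Y - X"] assms(2)
  by (simp add: Int_absorb1)

lemma content_on_Un:
  assumes "content_on U \<mu>" "X \<subseteq> U" "Y \<subseteq> U"
  shows "\<mu> (X \<union> Y) = \<mu> X + \<mu> Y - \<mu> (X \<inter> Y)"
proof -
  have "\<mu> (X \<union> (Y - X)) = \<mu> X + \<mu> (Y - X)"
    using assms by (intro content_on_Un_disjoint) auto
  then show ?thesis
    using content_on_Diff[OF assms(1,3), of X] by (simp add: Int_commute)
qed

lemma content_on_empty:
  assumes "content_on U \<mu>"
  shows "\<mu> {} = 0"
  using content_on_Un_disjoint[OF assms, of "{}" "{}"] by simp

lemma content_on_UN_le:
  assumes "content_on U \<mu>" "finite I" "\<And>i. i \<in> I \<Longrightarrow> X i \<subseteq> U"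
  shows "\<mu> (\<Union>i\<in>I. X i) \<le> (\<Sum>i\<in>I. \<mu> (X i))"
  using assms(2,3)
proof (induction I)
  case empty
  then show ?case by (simp add: content_on_empty[OF assms(1)])
next
  case (insert i I)
  have "\<mu> (X i \<union> (\<Union>j\<in>I. X j)) \<le> \<mu> (X i) + \<mu> (\<Union>j\<in>I. X j)"
    using content_on_Un[OF assms(1), of "X i" "\<Union>j\<in>I. X j"] insert.prems
      content_on_nonneg[OF assms(1), of "X i \<inter> (\<Union>j\<in>I. X j)"] by (simp add: UN_least)
  then show ?case using insert by simp
qed

text \<open>Bonferroni's inequality, with the pair count bounded by \<open>n\<^sup>2 / 2\<close>.\<close>

lemma content_on_UN_ge:
  assumes \<mu>: "content_on U \<mu>" and "finite I"
    and "\<And>i. i \<in> I \<Longrightarrow> X i \<subseteq> U" "\<And>i. i \<in> I \<Longrightarrow> \<mu> (X i) = b"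
    and "\<And>i j. i \<in> I \<Longrightarrow> j \<in> I \<Longrightarrow> i \<noteq> j \<Longrightarrow> \<mu> (X i \<inter> X j) \<le> c"
    and "c \<ge> 0"
  shows "real (card I) * b - (real (card I))\<^sup>2 / 2 * c \<le> \<mu> (\<Union>i\<in>I. X i)"
  using assms(2-5)
proof (induction I)
  case empty
  show ?case by (simp add: content_on_empty[OF \<mu>])
next
  case (insert i I)
  let ?V = "\<Union>j\<in>I. X j"
  have "\<mu> (X i \<inter> ?V) = \<mu> (\<Union>j\<in>I. X i \<inter> X j)" by simp
  also have "\<dots> \<le> (\<Sum>j\<in>I. \<mu> (X i \<inter> X j))"
    using insert by (intro content_on_UN_le[OF \<mu>]) auto
  also have "\<dots> \<le> (\<Sum>j\<in>I. c)"
    using insert.prems(3) insert.hyps by (intro sum_mono) (metis insertI1 insertI2)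
  finally have "\<mu> (X i \<inter> ?V) \<le> real (card I) * c" by simp
  moreover have "\<mu> (X i \<union> ?V) = \<mu> (X i) + \<mu> ?V - \<mu> (X i \<inter> ?V)"
    using insert by (intro content_on_Un[OF \<mu>]) auto
  moreover have "real (card I) * b - (real (card I))\<^sup>2 / 2 * c \<le> \<mu> ?V"
    using insert by blast
  moreover have "\<mu> (X i) = b" using insert by blast
  ultimately have "b + (real (card I) * b - (real (card I))\<^sup>2 / 2 * c) - real (card I) * c \<le> \<mu> (X i \<union> ?V)"
    by linarith
  moreover have "real (card (insert i I)) * b - (real (card (insert i I)))\<^sup>2 / 2 * c
      = b + (real (card I) * b - (real (card I))\<^sup>2 / 2 * c) - real (card I) * c - c / 2"
    using insert(1,2) by (simp add: algebra_simps power2_eq_square add_divide_distrib)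
  ultimately show ?case using \<open>c \<ge> 0\<close> by simp
qed

lemma translation_Int:
  fixes e :: "'a::ab_group_add"
  shows "(+) e ` (X \<inter> Y) = (+) e ` X \<inter> (+) e ` Y"
  by (simp add: image_Int)

section \<open>Sums of an approximate subgroup and the Massicot-Wagner argument\<close>

lemma set_plus_quadruple_elim:
  assumes "x \<in> S + S + S + S"
  obtains a b c d where "a \<in> S" "b \<in> S" "c \<in> S" "d \<in> S" "x = a + b + c + d"
  using assms unfolding set_plus_def by blast

lemma set_plus_quadruple_subset:
  fixes A F :: "'a::ab_group_add set"
  assumes "A + A \<subseteq> A + F"
  shows "A + A + A + A \<subseteq> A + (F + F + F)"
proof -
  have "A + A + A + A \<subseteq> A + F + A + A"
    by (intro set_plus_mono2[OF set_plus_mono2[OF assms]] order_refl)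
  also have "\<dots> = (A + A) + (F + A)" by (simp add: add_ac)
  also have "\<dots> \<subseteq> (A + F) + (F + A)" by (intro set_plus_mono2[OF assms] order_refl)
  also have "\<dots> = (A + A) + (F + F)" by (simp add: add_ac)
  also have "\<dots> \<subseteq> (A + F) + (F + F)" by (intro set_plus_mono2[OF assms] order_refl)
  finally show ?thesis by (simp add: add_ac)
qed

text \<open>If no \<open>B\<close> were stable, one could pass from \<open>A\<close> to ever smaller
  sets, each time lowering the content of \<open>B + A\<close> by more than \<delta>. The threshold
  \<open>(\<mu> B)\<^sup>2 / 4\<close> keeps the content of \<open>B\<close> positive at each stage,
  and after more than \<open>1 / \<delta>\<close> stages the content of \<open>B + A\<close> would
  be negative.\<close>

lemma set_plus_decreasing_stable:
  fixes A :: "'a::ab_group_add set"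
  assumes \<mu>: "content_on U \<mu>" and "A + A \<subseteq> U" "A \<subseteq> U" "\<mu> A > 0" "\<delta> > 0"
  obtains B where "B \<subseteq> A" "\<mu> B > 0"
    "\<And>B'. B' \<subseteq> B \<Longrightarrow> \<mu> B' \<ge> (\<mu> B)\<^sup>2 / 4 \<Longrightarrow> \<mu> (B' + A) \<ge> \<mu> (B + A) - \<delta>"
proof (rule ccontr)
  assume contra: "\<not> thesis"
  note witness = that
  have no: "\<exists>B'\<subseteq>B. \<mu> B' \<ge> (\<mu> B)\<^sup>2 / 4 \<and> \<mu> (B' + A) < \<mu> (B + A) - \<delta>"
    if "B \<subseteq> A" "\<mu> B > 0" for B
    using that contra witness[of B] by (meson not_less)
  have ex: "\<exists>B\<subseteq>A. \<mu> B > 0 \<and> \<mu> (B + A) \<le> 1 - real n * \<delta>" for n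
  proof (induction n)
    case 0
    have "\<mu> (A + A) \<le> \<mu> U" using assms by (intro content_on_mono[OF \<mu>]) auto
    then show ?case using assms content_on_full[OF \<mu>] by auto
  next
    case (Suc n)
    then obtain B where B: "B \<subseteq> A" "\<mu> B > 0" "\<mu> (B + A) \<le> 1 - real n * \<delta>" by blast
    then obtain B' where B': "B' \<subseteq> B" "\<mu> B' \<ge> (\<mu> B)\<^sup>2 / 4" "\<mu> (B' + A) < \<mu> (B + A) - \<delta>"
      using no by blast
    have "\<mu> B' > 0" using B' B by (smt (verit) zero_less_power divide_pos_pos)
    then show ?case using B B' by (intro exI[of _ B']) (auto simp: algebra_simps)
  qed
  obtain n where n: "real n * \<delta> > 1" using \<open>\<delta> > 0\<close> reals_Archimedean3 by blast
  show False using ex[of n] n content_on_nonneg[OF \<mu>] by (smt (verit))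
qed

text \<open>With \<open>B\<close> as in the previous lemma, \<open>S\<close> consists of the translations moving \<open>B\<close> to a set of
  substantial overlap with \<open>B\<close>. Each of them almost preserves \<open>B + A\<close>, hence so does a sum of eight,
  which is thus a difference of two elements of \<open>B + A\<close>.\<close>

lemma massicot_wagner:
  fixes A :: "'a::ab_group_add set"
  assumes "approximate_subgroup A"
  shows "\<exists>S. approximate_subgroup S \<and> (\<exists>Z. finite Z \<and> A \<subseteq> S + Z) \<and>
           (S + S + S + S) + (S + S + S + S) \<subseteq> A + A + A + A"
proof -
  have A0: "0 \<in> A" and Asym: "\<And>x. x \<in> A \<Longrightarrow> - x \<in> A"
    using assms by (auto simp: approximate_subgroup_def)
  obtain F where F: "finite F" "A + A \<subseteq> A + F"
    using assms by (auto simp: approximate_subgroup_def)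
  \<comment> \<open>Four summands leave room for every translation used below: moving a subset of
    \<open>A + A\<close> by a difference of two elements of \<open>A\<close> does not leave
    \<open>U\<close>.\<close>
  define U where "U = A + A + A + A"
  define F3 where "F3 = F + F + F"
  have F3: "finite F3" "U \<subseteq> A + F3"
    using F set_plus_quadruple_subset[OF F(2)] by (auto simp: F3_def U_def intro: finite_set_plus)
  have A2: "A + A \<subseteq> U"
    unfolding U_def using A0 set_zero_plus2[of A] by (metis add.commute order_trans)
  have A1: "A \<subseteq> A + A" using A0 by (rule set_zero_plus2)
  then have AU: "A \<subseteq> U" using A2 by blast
  have A4: "x + y + z + w \<in> U" if "x \<in> A" "y \<in> A" "z \<in> A" "w \<in> A" for x y z w
    using that by (auto simp: U_def)
  obtain \<mu> where \<mu>: "content_on U \<mu>"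
    and inv: "\<And>X e. X \<subseteq> U \<Longrightarrow> (+) e ` X \<subseteq> U \<Longrightarrow> \<mu> ((+) e ` X) = \<mu> X"
    using invariant_content_exists[of U] AU A0 by blast
  \<comment> \<open>Finitely many translates of \<open>A\<close> cover \<open>U\<close>, and the
    part of each inside \<open>U\<close> has content at most that of \<open>A\<close>; these
    contents cannot all vanish.\<close>
  have \<mu>A: "\<mu> A > 0"
  proof (rule ccontr)
    assume "\<not> \<mu> A > 0"
    then have z: "\<mu> A = 0" using content_on_nonneg[OF \<mu>, of A] by linarith
    have "\<mu> (U \<inter> (+) f ` A) \<le> 0" for f
    proof -
      have eq: "(+) f ` (A \<inter> (+) (- f) ` U) = U \<inter> (+) f ` A"
        unfolding translation_Int by (simp add: image_image Int_commute)
      have "\<mu> (U \<inter> (+) f ` A) = \<mu> (A \<inter> (+) (- f) ` U)"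
        using inv[of "A \<inter> (+) (- f) ` U" f] AU unfolding eq by blast
      also have "\<dots> \<le> \<mu> A" using AU by (intro content_on_mono[OF \<mu>]) auto
      finally show ?thesis using z by simp
    qed
    then have "(\<Sum>f\<in>F3. \<mu> (U \<inter> (+) f ` A)) \<le> 0" by (simp add: sum_nonpos)
    moreover have "\<mu> (\<Union>f\<in>F3. U \<inter> (+) f ` A) \<le> (\<Sum>f\<in>F3. \<mu> (U \<inter> (+) f ` A))"
      using F3 by (intro content_on_UN_le[OF \<mu>]) auto
    moreover have "(\<Union>f\<in>F3. U \<inter> (+) f ` A) = U"
    proof (intro equalityI subsetI)
      fix u assume u: "u \<in> U"
      then obtain a f where "a \<in> A" "f \<in> F3" "u = a + f"
        using F3(2) by (meson set_plus_elim subsetD)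
      then have "u = f + a" by (simp add: add.commute)
      then show "u \<in> (\<Union>f\<in>F3. U \<inter> (+) f ` A)" using u \<open>a \<in> A\<close> \<open>f \<in> F3\<close> by blast
    qed blast
    ultimately show False using content_on_full[OF \<mu>] by simp
  qed
  \<comment> \<open>Eight steps, each losing at most \<delta>, cost at most half of
    \<open>\<mu> A\<close>, which is less than \<open>\<mu> D\<close>.\<close>
  define \<delta> where "\<delta> = \<mu> A / 16"
  have \<delta>: "\<delta> > 0" using \<mu>A by (simp add: \<delta>_def)
  obtain B where B: "B \<subseteq> A" "\<mu> B > 0"
    and stable: "\<And>B'. B' \<subseteq> B \<Longrightarrow> \<mu> B' \<ge> (\<mu> B)\<^sup>2 / 4 \<Longrightarrow> \<mu> (B' + A) \<ge> \<mu> (B + A) - \<delta>"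
    using set_plus_decreasing_stable[OF \<mu> A2 AU \<mu>A \<delta>] by blast
  define b where "b = \<mu> B"
  define D where "D = B + A"
  \<comment> \<open>The overlap \<open>b\<^sup>2 / 4\<close> is large enough for the stability of
    \<open>B\<close> to apply to it and small enough for Bonferroni to bound the number of
    translates overlapping less than this.\<close>
  define S where "S = {g. \<mu> ((+) g ` B \<inter> B) \<ge> b\<^sup>2 / 4}"
  have b: "0 < b" "b \<le> 1"
    using B content_on_mono[OF \<mu>, of B U] content_on_full[OF \<mu>] AU by (auto simp: b_def)
  have DA: "D \<subseteq> A + A" unfolding D_def using B by (intro set_plus_mono2) auto
  have BU: "B \<subseteq> U" using B AU by blast
  have transl: "\<mu> ((+) g ` B \<inter> (+) h ` B) = \<mu> ((+) (g - h) ` B \<inter> B)"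
    if "(+) h ` B \<subseteq> U" for g h
  proof -
    have eq: "(+) h ` ((+) (g - h) ` B \<inter> B) = (+) g ` B \<inter> (+) h ` B"
      unfolding translation_Int by (simp add: image_image)
    show ?thesis
      using inv[of "(+) (g - h) ` B \<inter> B" h] that BU unfolding eq by blast
  qed
  have S0: "0 \<in> S"
  proof -
    have "b\<^sup>2 \<le> b" using b by (simp add: power2_eq_square mult_left_le)
    then show ?thesis using b by (simp add: S_def) (simp add: b_def)
  qed
  have SA: "\<exists>x\<in>B. \<exists>y\<in>B. g = x - y" if "g \<in> S" for g
  proof -
    have "\<mu> ((+) g ` B \<inter> B) > 0" using that b unfolding S_def
      by (smt (verit) mem_Collect_eq zero_less_power divide_pos_pos)
    then have "(+) g ` B \<inter> B \<noteq> {}" using content_on_empty[OF \<mu>] by auto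
    then obtain x y where "x \<in> B" "y \<in> B" "x = g + y" by blast
    then show ?thesis by (metis add_diff_cancel_right')
  qed
  have Ssym: "- g \<in> S" if "g \<in> S" for g
  proof -
    have eq: "(+) (- g) ` ((+) g ` B \<inter> B) = (+) (- g) ` B \<inter> B"
      unfolding translation_Int by (simp add: image_image Int_commute)
    have "\<mu> ((+) (- g) ` B \<inter> B) = \<mu> ((+) g ` B \<inter> B)"
      using inv[of "(+) g ` B \<inter> B" "- g"] BU unfolding eq by blast
    then show ?thesis using that by (simp add: S_def)
  qed
  have cover: "\<exists>Z. finite Z \<and> A \<subseteq> S + Z"
  proof -
    \<comment> \<open>A separated subset of \<open>A\<close> of greatest cardinality is a net: any
      further \<open>a\<close> differs from some member by an element of \<open>S\<close>.\<close>
    define sep where "sep Z \<longleftrightarrow> finite Z \<and> Z \<subseteq> A \<and> (\<forall>x\<in>Z. \<forall>y\<in>Z. x \<noteq> y \<longrightarrow> x - y \<notin> S)" for Z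
    have BA: "(+) a ` B \<subseteq> U" if "a \<in> A" for a
    proof -
      have "(+) a ` B \<subseteq> A + A" using that B by auto
      then show ?thesis using A2 by blast
    qed
    \<comment> \<open>With \<open>t = real N * b\<close> between 2 and 3, Bonferroni gives
      \<open>N\<close> separated translates of \<open>B\<close> a union of content at least
      \<open>t - t\<^sup>2 / 8\<close>, which is at least 3/2 on that interval and so exceeds the
      content of \<open>U\<close>.\<close>
    define N where "N = nat \<lceil>2 / b\<rceil>"
    have N: "2 \<le> real N * b" "real N * b \<le> 3"
    proof -
      have "2 / b \<le> real N" "real N \<le> 2 / b + 1"
        using divide_pos_pos[of 2 b] b unfolding N_def by linarith+
      then have "2 / b * b \<le> real N * b" "real N * b \<le> (2 / b + 1) * b"
        using b by (auto intro!: mult_right_mono simp del: times_divide_eq_left)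
      then show "2 \<le> real N * b" "real N * b \<le> 3" using b by (simp_all add: distrib_right)
    qed
    have small: "card Z < N" if Z: "sep Z" for Z
    proof (rule ccontr)
      assume "\<not> card Z < N"
      then obtain Y where Y: "Y \<subseteq> Z" "card Y = N" "finite Y"
        using Z unfolding sep_def by (metis not_less obtain_subset_with_card_n finite_subset)
      have YA: "y \<in> A" if "y \<in> Y" for y using that Y Z by (auto simp: sep_def)
      have "real (card Y) * b - (real (card Y))\<^sup>2 / 2 * (b\<^sup>2 / 4) \<le> \<mu> (\<Union>y\<in>Y. (+) y ` B)"
      proof (rule content_on_UN_ge[OF \<mu> Y(3)])
        show "(+) y ` B \<subseteq> U" if "y \<in> Y" for y using BA YA that by blast
        show "\<mu> ((+) y ` B) = b" if "y \<in> Y" for y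
          using inv[of B y] BU BA[OF YA[OF that]] by (simp add: b_def)
        show "\<mu> ((+) x ` B \<inter> (+) y ` B) \<le> b\<^sup>2 / 4" if "x \<in> Y" "y \<in> Y" "x \<noteq> y" for x y
        proof -
          have "x - y \<notin> S" using that Y Z by (auto simp: sep_def)
          then show ?thesis using transl[OF BA[OF YA[OF that(2)]], of x] by (simp add: S_def)
        qed
      qed simp
      also have "\<dots> \<le> \<mu> U" using BA YA by (intro content_on_mono[OF \<mu>]) auto
      finally have "(real N * b) - (real N * b)\<^sup>2 / 8 \<le> 1"
        using content_on_full[OF \<mu>] Y by (simp add: power_mult_distrib)
      moreover have "0 \<le> (real N * b - 2) * (3 - real N * b)" using N by simp
      ultimately show False using N by (simp add: algebra_simps power2_eq_square)
    qed
    have "sep {}" by (simp add: sep_def)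
    then obtain Z where Z: "sep Z" "\<And>Z'. sep Z' \<Longrightarrow> card Z' \<le> card Z"
      using ex_has_greatest_nat[of sep "{}" card N] small by (meson less_imp_le)
    have "A \<subseteq> S + Z"
    proof
      fix a assume a: "a \<in> A"
      show "a \<in> S + Z"
      proof (cases "a \<in> Z")
        case True
        then have "0 + a \<in> S + Z" using S0 by blast
        then show ?thesis by simp
      next
        case False
        have "\<not> sep (insert a Z)"
        proof
          assume "sep (insert a Z)"
          from Z(2)[OF this] show False using False Z(1) by (simp add: sep_def)
        qed
        moreover have "sep (insert a Z)" if "\<forall>z\<in>Z. a - z \<notin> S \<and> z - a \<notin> S"
          using Z(1) a that by (auto simp: sep_def)
        ultimately obtain z where z: "z \<in> Z" "a - z \<in> S \<or> z - a \<in> S" by blast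
        then have "a - z \<in> S" using Ssym[of "z - a"] by auto
        then have "(a - z) + z \<in> S + Z" using z by blast
        then show ?thesis by simp
      qed
    qed
    then show ?thesis using Z(1) by (auto simp: sep_def)
  qed
  \<comment> \<open>The overlap of \<open>B\<close> with its translate, summed with
    \<open>A\<close>, lies both in \<open>D\<close> and in the translate of \<open>D\<close>;
    stability says that this sum has nearly the content of \<open>D\<close>.\<close>
  have one: "\<mu> (D - (+) g ` D) \<le> \<delta>" if g: "g \<in> S" for g
  proof -
    let ?B' = "(+) g ` B \<inter> B"
    have "\<mu> (?B' + A) \<ge> \<mu> D - \<delta>"
      unfolding D_def using g by (intro stable) (auto simp: S_def b_def)
    moreover have "?B' + A \<subseteq> D \<inter> (+) g ` D"
    proof
      fix x assume "x \<in> ?B' + A"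
      then obtain c a where c: "c \<in> ?B'" "a \<in> A" "x = c + a" by (meson set_plus_elim)
      then obtain b' where "b' \<in> B" "c = g + b'" by blast
      moreover have "b' + a \<in> D" "c + a \<in> D"
        unfolding D_def using c \<open>b' \<in> B\<close> by blast+
      ultimately have "b' + a \<in> D" "x = g + (b' + a)" "x \<in> D"
        using c by (simp_all add: add.assoc)
      then show "x \<in> D \<inter> (+) g ` D" by blast
    qed
    then have "\<mu> (?B' + A) \<le> \<mu> (D \<inter> (+) g ` D)"
      using DA A2 by (intro content_on_mono[OF \<mu>]) auto
    moreover have "\<mu> (D - (+) g ` D) = \<mu> D - \<mu> (D \<inter> (+) g ` D)"
      using DA A2 by (intro content_on_Diff[OF \<mu>]) auto
    ultimately show ?thesis by linarith
  qed
  \<comment> \<open>What \<open>D\<close> loses under \<open>s + g\<close> is either lost under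
    \<open>g\<close> already or is the \<open>g\<close>-translate of what is lost under
    \<open>s\<close>. That translate stays inside \<open>U\<close>, so its content is unchanged and
    the losses add up.\<close>
  have step: "\<mu> (D - (+) (s + g) ` D) \<le> \<mu> (D - (+) s ` D) + \<delta>" if g: "g \<in> S" for s g
  proof -
    let ?R = "D - (+) s ` D"
    obtain x y where xy: "x \<in> A" "y \<in> A" "g = x - y" using SA[OF g] B by blast
    have RU: "(+) g ` ?R \<subseteq> U"
    proof clarify
      fix r assume "r \<in> D"
      then obtain p q where "p \<in> A" "q \<in> A" "r = p + q" using DA by (meson set_plus_elim subsetD)
      then have "x + (- y) + p + q \<in> U" using xy Asym by (intro A4) auto
      moreover have "x + (- y) + p + q = g + r" using \<open>r = p + q\<close> xy by (simp add: algebra_simps)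
      ultimately show "g + r \<in> U" by simp
    qed
    have sub: "D - (+) (s + g) ` D \<subseteq> (D - (+) g ` D) \<union> (+) g ` ?R"
    proof
      fix x assume x: "x \<in> D - (+) (s + g) ` D"
      show "x \<in> (D - (+) g ` D) \<union> (+) g ` ?R"
      proof (cases "x \<in> (+) g ` D")
        case True
        then obtain d where d: "d \<in> D" "x = g + d" by blast
        have "d \<notin> (+) s ` D" using x d by (auto simp: add.assoc add.left_commute)
        then show ?thesis using d by blast
      qed (use x in blast)
    qed
    have DU: "D \<subseteq> U" using DA A2 by blast
    have "\<mu> (D - (+) (s + g) ` D) \<le> \<mu> ((D - (+) g ` D) \<union> (+) g ` ?R)"
      using sub RU DU by (intro content_on_mono[OF \<mu>]) auto
    also have "\<dots> \<le> \<mu> (D - (+) g ` D) + \<mu> ((+) g ` ?R)"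
      using content_on_Un[OF \<mu>, of "D - (+) g ` D" "(+) g ` ?R"] RU DU
        content_on_nonneg[OF \<mu>] by (smt (verit) Diff_subset subset_trans)
    also have "\<mu> ((+) g ` ?R) = \<mu> ?R" using inv[of ?R g] RU DU by blast
    finally show ?thesis using one[OF g] by simp
  qed
  have four: "\<mu> (D - (+) (s + u) ` D) \<le> \<mu> (D - (+) s ` D) + 4 * \<delta>"
    if "u \<in> S + S + S + S" for s u
  proof -
    obtain g1 g2 g3 g4 where g: "g1 \<in> S" "g2 \<in> S" "g3 \<in> S" "g4 \<in> S" and u: "u = g1 + g2 + g3 + g4"
      using \<open>u \<in> S + S + S + S\<close> by (rule set_plus_quadruple_elim)
    have su: "s + u = s + g1 + g2 + g3 + g4" by (simp add: u add.assoc)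
    show ?thesis
      unfolding su using step[OF g(1), of s] step[OF g(2), of "s + g1"] step[OF g(3), of "s + g1 + g2"]
        step[OF g(4), of "s + g1 + g2 + g3"] by linarith
  qed
  \<comment> \<open>A translation by \<open>t\<close> that loses less than all of \<open>D\<close>
    makes \<open>D\<close> meet its translate, so \<open>t\<close> is a difference of two elements
    of \<open>A + A\<close>.\<close>
  have eight: "(S + S + S + S) + (S + S + S + S) \<subseteq> U"
  proof
    fix t assume "t \<in> (S + S + S + S) + (S + S + S + S)"
    then obtain u v where "t = u + v" and u: "u \<in> S + S + S + S" and v: "v \<in> S + S + S + S"
      by (rule set_plus_elim)
    then have "\<mu> (D - (+) t ` D) \<le> 8 * \<delta>"
      using four[OF u, of 0] four[OF v, of u] content_on_empty[OF \<mu>] by simp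
    moreover have "\<mu> D \<ge> \<mu> A"
    proof -
      obtain x where x: "x \<in> B" using B content_on_empty[OF \<mu>] by fastforce
      have "(+) x ` A \<subseteq> D" using x by (auto simp: D_def)
      then show ?thesis
        using content_on_mono[OF \<mu>, of "(+) x ` A" D] inv[of A x] DA A2 AU by (metis order_trans)
    qed
    ultimately have "\<mu> (D - (+) t ` D) < \<mu> D" using \<mu>A by (simp add: \<delta>_def)
    then have "D \<inter> (+) t ` D \<noteq> {}" by (metis Diff_triv less_irrefl)
    then obtain d d' where d: "d \<in> A + A" "d' \<in> A + A" "d = t + d'" using DA by blast
    then obtain p q p' q' where "p \<in> A" "q \<in> A" "p' \<in> A" "q' \<in> A" "d = p + q" "d' = p' + q'"
      by (meson set_plus_elim)
    then have "p + q + - p' + - q' \<in> U" by (intro A4 Asym)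
    moreover have "p + q + - p' + - q' = t"
      using d(3) \<open>d = p + q\<close> \<open>d' = p' + q'\<close> by (simp add: algebra_simps)
    ultimately show "t \<in> U" by simp
  qed
  obtain Z where Z: "finite Z" "A \<subseteq> S + Z" using cover by blast
  \<comment> \<open>The doubling property is inherited through \<open>U\<close>:
    \<open>S + S\<close> lies in \<open>U\<close>, \<open>U\<close> in \<open>A + F3\<close>, and
    \<open>A\<close> in \<open>S + Z\<close>.\<close>
  have "S + S \<subseteq> S + (Z + F3)"
  proof -
    have "S + S \<subseteq> U"
    proof -
      have "0 \<in> S + S" using S0 by (metis add.right_neutral set_plus_intro)
      then have "S + S \<subseteq> (S + S) + (S + S)" by (rule set_zero_plus2)
      moreover have "0 \<in> (S + S) + (S + S)" using \<open>0 \<in> S + S\<close> by (metis add.right_neutral set_plus_intro)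
      then have "(S + S) + (S + S) \<subseteq> ((S + S) + (S + S)) + ((S + S) + (S + S))" by (rule set_zero_plus2)
      ultimately show ?thesis using eight by (simp add: add.assoc)
    qed
    also have "\<dots> \<subseteq> A + F3" by (rule F3)
    also have "\<dots> \<subseteq> (S + Z) + F3" using Z by (intro set_plus_mono2) auto
    finally show ?thesis by (simp add: add.assoc)
  qed
  then have "approximate_subgroup S"
    using S0 Ssym Z F3 unfolding approximate_subgroup_def by (meson finite_set_plus)
  then show ?thesis using cover eight unfolding U_def by blast
qed

section \<open>Seminorms\<close>

definition group_seminorm :: "('a::ab_group_add \<Rightarrow> real) \<Rightarrow> bool" where
  "group_seminorm N \<longleftrightarrow> N 0 = 0 \<and> (\<forall>x. 0 \<le> N x) \<and> (\<forall>x. N (- x) = N x) \<and>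
     (\<forall>x y. N (x + y) \<le> N x + N y)"

text \<open>\<open>dyadic_sum V m k\<close> plays the role of the ball of radius \<open>k / 2 ^ m\<close>: the binary
  digits of \<open>k\<close> select which of the sets \<open>V 1, \<dots>, V m\<close> are added up.\<close>

fun dyadic_sum :: "(nat \<Rightarrow> 'a::ab_group_add set) \<Rightarrow> nat \<Rightarrow> nat \<Rightarrow> 'a set" where
  "dyadic_sum V 0 k = (if k = 0 then {0} else UNIV)"
| "dyadic_sum V (Suc m) k = dyadic_sum V m (k div 2) + (if odd k then V (Suc m) else {0})"

lemma set_plus_singleton_zero [simp]: "X + {0} = X" "{0} + X = X" for X :: "'a::ab_group_add set"
  by (auto simp: set_plus_def)

lemma dyadic_sum_0 [simp]: "dyadic_sum V m 0 = {0}"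
  by (induction m) auto

lemma dyadic_sum_double: "dyadic_sum V (Suc m) (2 * k) = dyadic_sum V m k"
  by simp

lemma dyadic_sum_shift: "dyadic_sum V (m + d) (2 ^ d * k) = dyadic_sum V m k"
proof (induction d)
  case (Suc d)
  have "dyadic_sum V (m + Suc d) (2 ^ Suc d * k) = dyadic_sum V (Suc (m + d)) (2 * (2 ^ d * k))"
    by (simp add: mult.assoc)
  then show ?case using Suc by (simp only: dyadic_sum_double)
qed simp

lemma dyadic_sum_1: "dyadic_sum V (Suc m) 1 = V (Suc m)"
  by simp

text \<open>Binary addition with carry: two last digits equal to 1 contribute
  \<open>V (Suc m) + V (Suc m)\<close>, which the halving condition absorbs into one unit of the
  preceding level.\<close>

lemma dyadic_sum_add:
  assumes half: "\<And>n. V (Suc n) + V (Suc n) \<subseteq> V n"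
  shows "dyadic_sum V m j + dyadic_sum V m k \<subseteq> dyadic_sum V m (j + k)"
proof (induction m arbitrary: j k)
  case 0
  show ?case by auto
next
  case (Suc m)
  let ?W = "dyadic_sum V m" and ?V = "V (Suc m)"
  have eq: "dyadic_sum V (Suc m) j + dyadic_sum V (Suc m) k =
      (?W (j div 2) + ?W (k div 2)) + ((if odd j then ?V else {0}) + (if odd k then ?V else {0}))"
    by (simp add: add_ac)
  have base: "?W (j div 2) + ?W (k div 2) \<subseteq> ?W (j div 2 + k div 2)" by (rule Suc.IH)
  show ?case
  proof (cases "odd j \<and> odd k")
    case True
    \<comment> \<open>For \<open>m = 0\<close> the carry lands in \<open>dyadic_sum V 0 1\<close>,
      the whole group.\<close>
    have VW: "?V + ?V \<subseteq> ?W 1"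
    proof (cases m)
      case (Suc m')
      then show ?thesis using half[of m] by (simp only: dyadic_sum_1)
    qed simp
    have "dyadic_sum V (Suc m) j + dyadic_sum V (Suc m) k \<subseteq> ?W (j div 2 + k div 2) + ?W 1"
      unfolding eq using True set_plus_mono2[OF base VW] by simp
    also have "\<dots> \<subseteq> ?W (j div 2 + k div 2 + 1)" by (rule Suc.IH)
    also have "j div 2 + k div 2 + 1 = (j + k) div 2" using True by presburger
    finally show ?thesis using True by simp
  next
    case False
    then have d: "(j + k) div 2 = j div 2 + k div 2" by presburger
    have "(if odd j then ?V else {0}) + (if odd k then ?V else {0}) = (if odd (j + k) then ?V else {0})"
      using False by auto
    then show ?thesis
      unfolding eq using set_plus_mono2[OF base order_refl] d by simp
  qed
qed

text \<open>The Birkhoff-Kakutani construction: \<open>N x\<close> is the infimum of the dyadic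
  radii whose ball contains \<open>x\<close>. Subadditivity is addition of radii over a common
  denominator.\<close>

lemma seminorm_of_halving_sequence:
  fixes V :: "nat \<Rightarrow> 'a::ab_group_add set"
  assumes zero: "\<And>n. 0 \<in> V n" and sym: "\<And>n x. x \<in> V n \<Longrightarrow> - x \<in> V n"
    and half: "\<And>n. V (Suc n) + V (Suc n) \<subseteq> V n"
  obtains N where "group_seminorm N"
    "\<And>n x. x \<in> V (Suc n) \<Longrightarrow> N x \<le> 1 / 2 ^ Suc n"
    "\<And>n x. N x < 1 / 2 ^ Suc n \<Longrightarrow> x \<in> V (Suc n)"
proof -
  define W where "W = dyadic_sum V"
  define R where "R x = {real k / 2 ^ m | k m. x \<in> W m k}" for x
  define N where "N x = Inf (R x)" for x
  have Wadd: "W m j + W m k \<subseteq> W m (j + k)" for m j k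
    unfolding W_def by (rule dyadic_sum_add[of V, OF half])
  have Wzero: "0 \<in> W m k" for m k
    unfolding W_def
  proof (induction m arbitrary: k)
    case (Suc m)
    have "0 + 0 \<in> dyadic_sum V m (k div 2) + (if odd k then V (Suc m) else {0})"
      by (intro set_plus_intro Suc.IH) (auto simp: zero)
    then show ?case by simp
  qed simp
  have Wmono: "W m j \<subseteq> W m k" if "j \<le> k" for m j k
  proof -
    have "W m j \<subseteq> W m (k - j) + W m j" by (intro set_zero_plus2 Wzero)
    then show ?thesis using Wadd[of m "k - j" j] that by auto
  qed
  have Wsym: "- x \<in> W m k" if "x \<in> W m k" for x m k
    using that unfolding W_def
  proof (induction m arbitrary: k x)
    case (Suc m)
    then obtain u v where uv: "u \<in> dyadic_sum V m (k div 2)" "v \<in> (if odd k then V (Suc m) else {0})" "x = u + v"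
      by (auto elim!: set_plus_elim)
    then have "- u \<in> dyadic_sum V m (k div 2)" "- v \<in> (if odd k then V (Suc m) else {0})"
      using Suc.IH sym by (auto split: if_splits)
    then have "- u + - v \<in> dyadic_sum V m (k div 2) + (if odd k then V (Suc m) else {0})"
      by (rule set_plus_intro)
    then show ?case using uv by simp
  qed (auto split: if_splits)
  \<comment> \<open>At level 0 radius 1 is already the whole group, so \<open>N\<close> is a genuine
    infimum everywhere.\<close>
  have Rne: "R x \<noteq> {}" for x
  proof -
    have "x \<in> W 0 1" by (simp add: W_def)
    then show ?thesis unfolding R_def by blast
  qed
  have Rpos: "0 \<le> r" if "r \<in> R x" for r x
    using that by (auto simp: R_def)
  then have Rbdd: "bdd_below (R x)" for x by (intro bdd_belowI)
  have Nle: "N x \<le> real k / 2 ^ m" if "x \<in> W m k" for x k m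
    unfolding N_def using that by (intro cInf_lower Rbdd) (auto simp: R_def)
  have Nex: "\<exists>k m. x \<in> W m k \<and> real k / 2 ^ m < r" if "N x < r" for x r
    using that cInf_less_iff[OF Rne Rbdd, of x r] by (auto simp: N_def R_def)
  have N0: "0 \<le> N x" for x unfolding N_def using Rne Rpos by (intro cInf_greatest)
  have Nadd: "N (x + y) \<le> N x + N y" for x y
  proof (rule field_le_epsilon)
    fix e :: real assume "e > 0"
    then obtain j m k n where jk: "x \<in> W m j" "real j / 2 ^ m < N x + e / 2"
      "y \<in> W n k" "real k / 2 ^ n < N y + e / 2"
      using Nex[of x "N x + e / 2"] Nex[of y "N y + e / 2"] by auto
    have "x \<in> W (m + n) (2 ^ n * j)" using jk by (simp add: W_def dyadic_sum_shift)
    moreover have "y \<in> W (n + m) (2 ^ m * k)" using jk by (simp add: W_def dyadic_sum_shift)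
    then have "y \<in> W (m + n) (2 ^ m * k)" by (simp add: add.commute)
    ultimately have "x + y \<in> W (m + n) (2 ^ n * j + 2 ^ m * k)" using Wadd by blast
    then have "N (x + y) \<le> real (2 ^ n * j + 2 ^ m * k) / 2 ^ (m + n)" by (rule Nle)
    also have "\<dots> = real j / 2 ^ m + real k / 2 ^ n"
      by (simp add: power_add field_simps)
    finally show "N (x + y) \<le> N x + N y + e" using jk by linarith
  qed
  show thesis
  proof
    have "N 0 \<le> 0" using Nle[of 0 0 0] Wzero by simp
    moreover have "R (- x) = R x" for x
    proof -
      have "x \<in> W m k \<longleftrightarrow> - x \<in> W m k" for m k using Wsym[of x] Wsym[of "- x"] by auto
      then show ?thesis by (simp add: R_def)
    qed
    ultimately show "group_seminorm N"
      using N0 Nadd by (auto simp: group_seminorm_def N_def intro: antisym)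
    show "N x \<le> 1 / 2 ^ Suc n" if "x \<in> V (Suc n)" for n x
      using Nle[of x "Suc n" 1] that unfolding W_def dyadic_sum_1 by simp
    show "x \<in> V (Suc n)" if "N x < 1 / 2 ^ Suc n" for n x
    proof -
      obtain k m where km: "x \<in> W m k" "real k / 2 ^ m < 1 / 2 ^ Suc n" using Nex[OF \<open>N x < 1 / 2 ^ Suc n\<close>] by blast
      \<comment> \<open>Both radii get the denominator \<open>2 ^ (m + Suc n)\<close>, where
        monotonicity in the numerator compares \<open>k / 2 ^ m\<close> with
        \<open>1 / 2 ^ Suc n\<close>.\<close>
      have "x \<in> W (m + Suc n) (2 ^ Suc n * k)" using km by (simp only: W_def dyadic_sum_shift)
      moreover have "real (2 ^ Suc n * k) \<le> real (2 ^ m)"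
        using km(2) by (simp add: field_simps)
      then have "2 ^ Suc n * k \<le> 2 ^ m" by (simp only: of_nat_le_iff)
      ultimately have "x \<in> W (m + Suc n) (2 ^ m)" using Wmono by blast
      then have "x \<in> dyadic_sum V (Suc n + m) (2 ^ m * 1)" by (simp add: W_def add.commute)
      then show ?thesis by (simp only: dyadic_sum_shift dyadic_sum_1)
    qed
  qed
qed

text \<open>Iterating the refinement gives sets \<open>S n\<close> starting at \<open>A\<close>. The
  fourfold sums \<open>V n\<close> form a halving sequence precisely because eightfold sums of
  \<open>S (Suc n)\<close> lie in fourfold sums of \<open>S n\<close>. The finite covers compose, so
  finitely many translates of each \<open>S n\<close> cover \<open>A\<close>.\<close>

lemma approximate_subgroup_seminorm:
  fixes A :: "'a::ab_group_add set"
  assumes "approximate_subgroup A"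
  obtains N where "group_seminorm N" "\<And>x. N x < 1 / 2 \<Longrightarrow> x \<in> A + A + A + A"
    "\<And>\<epsilon>. \<epsilon> > 0 \<Longrightarrow> \<exists>Z. finite Z \<and> (\<forall>a\<in>A. \<exists>z\<in>Z. N (a - z) \<le> \<epsilon>)"
proof -
  define refines where "refines X Y \<longleftrightarrow> approximate_subgroup Y \<and> (\<exists>Z. finite Z \<and> X \<subseteq> Y + Z) \<and>
    (Y + Y + Y + Y) + (Y + Y + Y + Y) \<subseteq> X + X + X + X" for X Y :: "'a set"
  define S where "S n = ((\<lambda>X. SOME Y. refines X Y) ^^ n) A" for n :: nat
  have S_refines: "refines (S n) (S (Suc n))" if "approximate_subgroup (S n)" for n
  proof -
    have "\<exists>Y. refines (S n) Y" unfolding refines_def using that by (rule massicot_wagner)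
    then show ?thesis by (simp add: S_def someI_ex)
  qed
  have S1: "approximate_subgroup (S n)" for n
  proof (induction n)
    case 0
    show ?case using assms by (simp add: S_def)
  next
    case (Suc n)
    then show ?case using S_refines[of n] by (simp add: refines_def)
  qed
  have S2: "S 0 = A" by (simp add: S_def)
  note S_chain = S_refines[OF S1, unfolded refines_def, THEN conjunct2]
  have S3: "\<exists>Z. finite Z \<and> S n \<subseteq> S (Suc n) + Z" for n
    by (rule S_chain[THEN conjunct1])
  note S4 = S_chain[THEN conjunct2]
  define V where "V n = S n + S n + S n + S n" for n
  have S0: "0 \<in> S n" and Ssym: "x \<in> S n \<Longrightarrow> - x \<in> S n" for n x
    using S1[of n] by (auto simp: approximate_subgroup_def)
  have SV: "S n \<subseteq> V n" for n
  proof
    fix x assume "x \<in> S n"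
    then have "x + 0 + 0 + 0 \<in> V n" unfolding V_def by (intro set_plus_intro S0)
    then show "x \<in> V n" by simp
  qed
  have V0: "0 \<in> V n" for n using SV S0 by blast
  have Vsym: "- x \<in> V n" if "x \<in> V n" for n x
  proof -
    obtain a b c d where "a \<in> S n" "b \<in> S n" "c \<in> S n" "d \<in> S n" "x = a + b + c + d"
      using \<open>x \<in> V n\<close> unfolding V_def by (elim set_plus_quadruple_elim)
    moreover from this have "- a + - b + - c + - d \<in> V n"
      unfolding V_def by (intro set_plus_intro Ssym)
    ultimately show ?thesis by (simp add: algebra_simps)
  qed
  have Vhalf: "V (Suc n) + V (Suc n) \<subseteq> V n" for n
    unfolding V_def by (rule S4)
  obtain N where N: "group_seminorm N"
    "\<And>n x. x \<in> V (Suc n) \<Longrightarrow> N x \<le> 1 / 2 ^ Suc n"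
    "\<And>n x. N x < 1 / 2 ^ Suc n \<Longrightarrow> x \<in> V (Suc n)"
    using seminorm_of_halving_sequence[of V, OF V0 Vsym Vhalf] by blast
  have cover: "\<exists>Z. finite Z \<and> A \<subseteq> S n + Z" for n
  proof (induction n)
    case 0
    show ?case using S2 by (intro exI[of _ "{0}"]) simp
  next
    case (Suc n)
    then obtain Z where Z: "finite Z" "A \<subseteq> S n + Z" by blast
    obtain Y where Y: "finite Y" "S n \<subseteq> S (Suc n) + Y" using S3 by blast
    have "A \<subseteq> S (Suc n) + (Y + Z)"
      unfolding add.assoc[symmetric] by (rule order_trans[OF Z(2) set_plus_mono2[OF Y(2) order_refl]])
    then show ?case by (intro exI[of _ "Y + Z"] conjI finite_set_plus Y(1) Z(1))
  qed
  show thesis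
  proof
    show "group_seminorm N" by (rule N)
    show "x \<in> A + A + A + A" if "N x < 1 / 2" for x
    proof -
      \<comment> \<open>The comparison of \<open>N\<close> with the sets \<open>V\<close> starts at
        index 1, which is why the radius is 1/2; halving then leads to \<open>V 0\<close>.\<close>
      have "x \<in> V (Suc 0)" using N(3)[of x 0] that by simp
      then have "0 + x \<in> V (Suc 0) + V (Suc 0)" by (intro set_plus_intro V0)
      then have "x \<in> V 0" using Vhalf[of 0] by auto
      then show ?thesis by (simp only: V_def S2)
    qed
    fix \<epsilon> :: real assume "\<epsilon> > 0"
    then obtain n where n: "(1 / 2) ^ n < \<epsilon>" using real_arch_pow_inv[of \<epsilon> "1/2"] by auto
    have "1 / 2 ^ Suc n \<le> \<epsilon>"
    proof -
      have "1 / 2 ^ Suc n \<le> (1 / 2 :: real) ^ n" by (simp add: field_simps)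
      then show ?thesis using n by linarith
    qed
    obtain Z where Z: "finite Z" "A \<subseteq> S (Suc n) + Z" using cover by blast
    have "\<exists>z\<in>Z. N (a - z) \<le> \<epsilon>" if "a \<in> A" for a
    proof -
      obtain s z where "s \<in> S (Suc n)" "z \<in> Z" "a = s + z"
        using subsetD[OF Z(2) \<open>a \<in> A\<close>] by (elim set_plus_elim)
      moreover have "N s \<le> \<epsilon>"
        using N(2)[OF subsetD[OF SV \<open>s \<in> S (Suc n)\<close>]] \<open>1 / 2 ^ Suc n \<le> \<epsilon>\<close> by linarith
      ultimately show ?thesis by (intro bexI[of _ z]) auto
    qed
    then show "\<exists>Z. finite Z \<and> (\<forall>a\<in>A. \<exists>z\<in>Z. N (a - z) \<le> \<epsilon>)" using Z by blast
  qed
qed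

section \<open>Graphs of dense homomorphisms\<close>

text \<open>Total boundedness asks for centres in \<open>S\<close> itself. Each useful centre is
  replaced by a point of \<open>S\<close> in its ball of half the radius.\<close>

lemma (in Metric_space) mtotally_bounded_of_nets:
  assumes "S \<subseteq> M" and nets: "\<And>e. e > 0 \<Longrightarrow> \<exists>K. finite K \<and> S \<subseteq> (\<Union>x\<in>K. mball x e)"
  shows "mtotally_bounded S"
  unfolding mtotally_bounded_def
proof (intro allI impI)
  fix e :: real assume "e > 0"
  then obtain K where K: "finite K" "S \<subseteq> (\<Union>x\<in>K. mball x (e / 2))" using nets[of "e / 2"] by auto
  define K' where "K' = {x \<in> K. S \<inter> mball x (e / 2) \<noteq> {}}"
  define s where "s x = (SOME y. y \<in> S \<inter> mball x (e / 2))" for x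
  have s: "s x \<in> S \<inter> mball x (e / 2)" if "x \<in> K'" for x
    unfolding s_def by (rule someI_ex) (use that in \<open>auto simp: K'_def\<close>)
  have "y \<in> (\<Union>x\<in>s ` K'. mball x e)" if y: "y \<in> S" for y
  proof -
    obtain x where x: "x \<in> K" "y \<in> mball x (e / 2)" using subsetD[OF K(2) y] by blast
    then have "x \<in> K'" using y by (auto simp: K'_def)
    have sx: "s x \<in> M" "x \<in> M" "y \<in> M" "d x (s x) < e / 2" "d x y < e / 2"
      using s[OF \<open>x \<in> K'\<close>] x by auto
    then have "d (s x) y < e" using triangle[of "s x" x y] commute[of x "s x"] by linarith
    then show ?thesis using sx \<open>x \<in> K'\<close> by auto
  qed
  then show "\<exists>K. finite K \<and> K \<subseteq> S \<and> S \<subseteq> (\<Union>x\<in>K. mball x e)"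
  proof (intro exI conjI)
    show "finite (s ` K')" using K(1) by (simp add: K'_def)
    show "s ` K' \<subseteq> S" using s by blast
  qed blast
qed

text \<open>\<open>H\<close> is a carrier with explicit operations, as the group of the scheme is
  one. The estimates \<open>d_add\<close> and \<open>d_neg\<close> stand for continuity,
  \<open>ball_covered\<close> for local compactness, and \<open>ball_locally_finite\<close> for
  discreteness of the graph.\<close>

locale dense_metric_group = Metric_space M d
  for M :: "'h set" and d +
  fixes add :: "'h \<Rightarrow> 'h \<Rightarrow> 'h" and unit :: 'h and neg :: "'h \<Rightarrow> 'h"
    and \<phi> :: "'a::{topological_ab_group_add, t2_space} \<Rightarrow> 'h" and N :: "'a \<Rightarrow> real"
  assumes complete: "mcomplete"
    and add_closed: "\<And>x y. x \<in> M \<Longrightarrow> y \<in> M \<Longrightarrow> add x y \<in> M"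
    and neg_closed: "\<And>x. x \<in> M \<Longrightarrow> neg x \<in> M"
    and add_assoc: "\<And>x y z. x \<in> M \<Longrightarrow> y \<in> M \<Longrightarrow> z \<in> M \<Longrightarrow> add (add x y) z = add x (add y z)"
    and add_commute: "\<And>x y. x \<in> M \<Longrightarrow> y \<in> M \<Longrightarrow> add x y = add y x"
    and add_unit: "\<And>x. x \<in> M \<Longrightarrow> add unit x = x"
    and add_neg: "\<And>x. x \<in> M \<Longrightarrow> add (neg x) x = unit"
    and d_add: "\<And>x y x' y'. x \<in> M \<Longrightarrow> y \<in> M \<Longrightarrow> x' \<in> M \<Longrightarrow> y' \<in> M \<Longrightarrow>
      d (add x y) (add x' y') \<le> d x x' + d y y'"
    and d_neg: "\<And>x y. x \<in> M \<Longrightarrow> y \<in> M \<Longrightarrow> d (neg x) (neg y) \<le> d x y"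
    and hom_closed: "\<And>x. \<phi> x \<in> M"
    and hom_zero: "\<phi> 0 = unit"
    and hom_add: "\<And>x y. \<phi> (x + y) = add (\<phi> x) (\<phi> y)"
    and hom_neg: "\<And>x. \<phi> (- x) = neg (\<phi> x)"
    and d_hom: "\<And>x y. d (\<phi> x) (\<phi> y) = N (x - y)"
    and hom_dense: "\<And>x e. x \<in> M \<Longrightarrow> e > 0 \<Longrightarrow> \<exists>g. d x (\<phi> g) < e"
    and ball_covered: "\<And>e. e > 0 \<Longrightarrow> \<exists>Z. finite Z \<and> (\<forall>a. N a < 1 / 2 \<longrightarrow> (\<exists>z\<in>Z. N (a - z) \<le> e))"
    and ball_locally_finite: "locally_finite_set {a. N a < 1 / 2}"
begin

text \<open>In a complete space total boundedness is enough. Points of the ball are approximated by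
  images of group elements; relative to one such element near the centre, these lie in the seminorm
  ball of radius 1/2, which has finite nets.\<close>

lemma compactin_mcball:
  assumes c: "c \<in> M"
  shows "compactin mtopology (mcball c (1 / 4))"
proof -
  have "mtotally_bounded (mcball c (1 / 4))"
  proof (rule mtotally_bounded_of_nets)
    fix e :: real assume "e > 0"
    \<comment> \<open>The bound 1/16 keeps \<open>1/16 + 1/4 + 1/8\<close> below 1/2, and
      \<open>e / 3\<close> leaves room for two errors of size \<open>e'\<close>.\<close>
    define e' where "e' = min (e / 3) (1 / 16)"
    have e': "e' > 0" "e' \<le> 1 / 16" "3 * e' \<le> e" using \<open>e > 0\<close> by (auto simp: e'_def)
    obtain g where g: "d c (\<phi> g) < 1 / 8" using hom_dense[OF c, of "1/8"] by auto
    obtain Z where Z: "finite Z" "\<And>a. N a < 1 / 2 \<Longrightarrow> \<exists>z\<in>Z. N (a - z) \<le> e'"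
      using ball_covered[OF e'(1)] by blast
    have "\<exists>z\<in>Z. x \<in> mball (\<phi> (g + z)) e" if x: "x \<in> mcball c (1 / 4)" for x
    proof -
      have xM: "x \<in> M" and xc: "d x c \<le> 1 / 4" using x by (auto simp: commute)
      obtain y where y: "d x (\<phi> y) < e'" using hom_dense[OF xM e'(1)] by blast
      have "N (y - g) = d (\<phi> y) (\<phi> g)" by (simp add: d_hom)
      also have "\<dots> \<le> d (\<phi> y) x + d x (\<phi> g)" by (intro triangle hom_closed xM)
      also have "\<dots> \<le> d (\<phi> y) x + (d x c + d c (\<phi> g))" using triangle[OF xM c hom_closed] by simp
      also have "\<dots> < 1 / 2" using y xc g e'(2) commute[of "\<phi> y" x] by linarith
      finally obtain z where z: "z \<in> Z" "N (y - g - z) \<le> e'" using Z(2) by blast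
      have "d (\<phi> (g + z)) x \<le> d (\<phi> (g + z)) (\<phi> y) + d (\<phi> y) x" by (intro triangle hom_closed xM)
      also have "d (\<phi> (g + z)) (\<phi> y) = N (y - g - z)" by (simp add: commute[of _ "\<phi> y"] d_hom diff_diff_eq)
      finally have "d (\<phi> (g + z)) x < e" using z y e' commute[of "\<phi> y" x] by linarith
      then show ?thesis using z(1) xM hom_closed by auto
    qed
    then show "\<exists>K. finite K \<and> mcball c (1 / 4) \<subseteq> (\<Union>x\<in>K. mball x e)"
      using Z(1) by (intro exI[of _ "(\<lambda>z. \<phi> (g + z)) ` Z"]) blast
  qed auto
  then show ?thesis
    using mtotally_bounded_eq_compact_closure_of[OF complete, of "mcball c (1 / 4)"]
    by (simp add: closure_of_closedin)
qed

lemma lca_group_mtopology: "lca_group mtopology add unit neg"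
proof -
  have "locally_compact_space mtopology"
    unfolding locally_compact_space_def
  proof
    fix x assume x: "x \<in> topspace mtopology"
    show "\<exists>U K. openin mtopology U \<and> compactin mtopology K \<and> x \<in> U \<and> U \<subseteq> K"
      using x compactin_mcball[of x] by (intro exI[of _ "mball x (1/4)"] exI[of _ "mcball x (1/4)"]) auto
  qed
  moreover have "continuous_map (prod_topology mtopology mtopology) mtopology (\<lambda>(x, y). add x y)"
    unfolding continuous_map_def
  proof (intro conjI allI impI)
    show "(\<lambda>(x, y). add x y) \<in> topspace (prod_topology mtopology mtopology) \<rightarrow> topspace mtopology"
      using add_closed by auto
    fix U assume U: "openin mtopology U"
    show "openin (prod_topology mtopology mtopology)
        {p \<in> topspace (prod_topology mtopology mtopology). (\<lambda>(x, y). add x y) p \<in> U}"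
      unfolding openin_prod_topology_alt
    proof (intro allI impI)
      fix x y assume "(x, y) \<in> {p \<in> topspace (prod_topology mtopology mtopology). (\<lambda>(x, y). add x y) p \<in> U}"
      then have xy: "x \<in> M" "y \<in> M" "add x y \<in> U" by auto
      then obtain r where r: "r > 0" "mball (add x y) r \<subseteq> U" using U by (auto simp: openin_mtopology)
      have "add x' y' \<in> U" if "x' \<in> mball x (r / 2)" "y' \<in> mball y (r / 2)" for x' y'
      proof -
        have "d (add x y) (add x' y') < r" using that xy d_add[of x y x' y'] by auto
        then show ?thesis using that r(2) xy add_closed by auto
      qed
      then show "\<exists>V W. openin mtopology V \<and> openin mtopology W \<and> x \<in> V \<and> y \<in> W \<and>
          V \<times> W \<subseteq> {p \<in> topspace (prod_topology mtopology mtopology). (\<lambda>(x, y). add x y) p \<in> U}"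
        using xy r(1) by (intro exI[of _ "mball x (r/2)"] exI[of _ "mball y (r/2)"]) auto
    qed
  qed
  moreover have "continuous_map mtopology mtopology neg"
    unfolding continuous_map_def
  proof (intro conjI allI impI)
    show "neg \<in> topspace mtopology \<rightarrow> topspace mtopology" using neg_closed by auto
    fix U assume U: "openin mtopology U"
    show "openin mtopology {x \<in> topspace mtopology. neg x \<in> U}"
      unfolding openin_mtopology
    proof (intro conjI allI impI)
      fix x assume "x \<in> {x \<in> topspace mtopology. neg x \<in> U}"
      then have x: "x \<in> M" "neg x \<in> U" by auto
      then obtain r where r: "r > 0" "mball (neg x) r \<subseteq> U" using U by (auto simp: openin_mtopology)
      have "neg y \<in> U" if "y \<in> mball x r" for y
      proof -
        have "d (neg x) (neg y) < r" using that x d_neg[of x y] by auto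
        then show ?thesis using that r(2) x neg_closed by auto
      qed
      then show "\<exists>r>0. mball x r \<subseteq> {x \<in> topspace mtopology. neg x \<in> U}"
        using r(1) by (intro exI[of _ r]) auto
    qed auto
  qed
  moreover have "unit \<in> M" using hom_closed[of 0] by (simp add: hom_zero)
  ultimately show ?thesis
    using add_closed neg_closed add_assoc add_commute add_unit add_neg
    by (simp add: lca_group_def Hausdorff_space_mtopology)
qed

text \<open>Graph points with second coordinates closer than 1/2 differ in the first by an element
  of the seminorm ball of radius 1/2, and only finitely many such differences fit into a compact
  neighbourhood.\<close>

lemma graph_discrete:
  assumes lc: "locally_compact_space (euclidean :: 'a topology)"
  shows "subtopology (prod_topology euclidean mtopology) (range (\<lambda>x. (x, \<phi> x)))
    = discrete_topology (range (\<lambda>x. (x, \<phi> x)))"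
proof (rule subtopology_eq_discrete_topology, intro conjI)
  let ?L = "range (\<lambda>x. (x, \<phi> x))" and ?X = "prod_topology (euclidean :: 'a topology) mtopology"
  show "?L \<subseteq> topspace ?X" using hom_closed by auto
  have "(x, \<phi> x) \<notin> ?X derived_set_of ?L" for x
  proof -
    obtain O' K where O': "open O'" "compact K" "x \<in> O'" "O' \<subseteq> K"
      using lc[unfolded locally_compact_space_def, rule_format, of x] by auto
    have "compact ((\<lambda>y. y - x) ` K)"
      by (intro compact_continuous_image O' continuous_intros)
    then have "finite ({a. N a < 1 / 2} \<inter> (\<lambda>y. y - x) ` K)"
      using ball_locally_finite by (auto simp: locally_finite_set_def)
    then have fin: "finite ((\<lambda>a. a + x) ` ({a. N a < 1 / 2} \<inter> (\<lambda>y. y - x) ` K) - {x})" (is "finite ?E")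
      by simp
    \<comment> \<open>Removing the finitely many other candidates from \<open>O'\<close> leaves a
      neighbourhood whose only graph point sits over \<open>x\<close>.\<close>
    define T where "T = (O' - ?E) \<times> mball (\<phi> x) (1 / 2)"
    have "openin ?X T"
      unfolding T_def openin_prod_Times_iff
      using O' finite_imp_closed[OF fin] by (auto intro: open_Diff)
    moreover have "(x, \<phi> x) \<in> T" using O' hom_closed by (auto simp: T_def)
    moreover have "y = x" if "(y, \<phi> y) \<in> T" for y
    proof (rule ccontr)
      assume "y \<noteq> x"
      have "N (y - x) < 1 / 2" using that commute[of "\<phi> x" "\<phi> y"] by (simp add: T_def d_hom)
      moreover have "y - x \<in> (\<lambda>y. y - x) ` K" using that O' by (auto simp: T_def)
      ultimately have "(y - x) + x \<in> ?E" using \<open>y \<noteq> x\<close> by (intro DiffI imageI) auto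
      then show False using that by (simp add: T_def)
    qed
    then have "\<not> (\<exists>p\<noteq>(x, \<phi> x). p \<in> ?L \<and> p \<in> T)" by blast
    ultimately show ?thesis unfolding in_derived_set_of by blast
  qed
  then show "?L \<inter> ?X derived_set_of ?L = {}" by auto
qed

text \<open>For cocompactness, \<open>(g, h)\<close> is first moved by a graph point over
  \<open>l\<close> with \<open>\<phi> l\<close> near \<open>h\<close>, then by one over
  \<open>a \<in> \<Lambda>\<close> that brings \<open>g - l\<close> into \<open>K\<close>. The
  second coordinate left over is close to \<open>\<phi> (- a)\<close>, hence to one of the finitely
  many \<open>\<phi> (- z)\<close>.\<close>

lemma cut_and_project_graph:
  assumes lc: "locally_compact_space (euclidean :: 'a topology)"
    and dense: "relatively_dense \<Lambda>"
    and covered: "finite Z" "\<And>a. a \<in> \<Lambda> \<Longrightarrow> \<exists>z\<in>Z. N (a - z) \<le> 1 / 8"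
  shows "cut_and_project mtopology add unit neg (range (\<lambda>x. (x, \<phi> x)))"
proof -
  let ?L = "range (\<lambda>x. (x, \<phi> x))"
  obtain K where K: "compact K" "{x + k | x k. x \<in> \<Lambda> \<and> k \<in> K} = UNIV"
    using dense by (auto simp: relatively_dense_def)
  \<comment> \<open>The radius is the sum of the density error 1/8 and the net error 1/8, and is one
    for which closed balls are known to be compact.\<close>
  define C where "C = (\<Union>z\<in>Z. mcball (\<phi> (- z)) (1 / 4))"
  have "compactin mtopology C"
    unfolding C_def using covered(1) by (intro compactin_Union) (auto intro: compactin_mcball hom_closed)
  then have "compactin (prod_topology euclidean mtopology) (K \<times> C)"
    using K by (simp add: compactin_Times)
  moreover have "{(fst k + fst l, add (snd k) (snd l)) | k l. k \<in> K \<times> C \<and> l \<in> ?L} = UNIV \<times> topspace mtopology"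
  proof (intro equalityI subsetI)
    fix p assume "p \<in> {(fst k + fst l, add (snd k) (snd l)) | k l. k \<in> K \<times> C \<and> l \<in> ?L}"
    then show "p \<in> UNIV \<times> topspace mtopology"
      by (auto simp: C_def intro!: add_closed hom_closed)
  next
    fix p :: "'a \<times> 'h" assume "p \<in> UNIV \<times> topspace mtopology"
    then obtain g h where p: "p = (g, h)" "h \<in> M" by auto
    obtain l where l: "d h (\<phi> l) < 1 / 8" using hom_dense[OF p(2), of "1/8"] by auto
    have "g - l \<in> {x + k | x k. x \<in> \<Lambda> \<and> k \<in> K}" using K by simp
    then obtain a k where a: "a \<in> \<Lambda>" "k \<in> K" "g - l = a + k" by blast
    obtain z where z: "z \<in> Z" "N (a - z) \<le> 1 / 8" using covered(2)[OF a(1)] by blast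
    define h' where "h' = add h (neg (\<phi> (l + a)))"
    have h': "h' \<in> M" unfolding h'_def by (intro add_closed neg_closed hom_closed p)
    have "\<phi> (- z) = add (\<phi> (l + a - z)) (neg (\<phi> (l + a)))"
      unfolding hom_neg[symmetric] hom_add[symmetric] by simp
    then have "d (\<phi> (- z)) h' \<le> d (\<phi> (l + a - z)) h + d (neg (\<phi> (l + a))) (neg (\<phi> (l + a)))"
      unfolding h'_def by (simp only:) (intro d_add neg_closed hom_closed p)
    also have "\<dots> = d (\<phi> (l + a - z)) h" using hom_closed neg_closed by simp
    also have "\<dots> \<le> d (\<phi> (l + a - z)) (\<phi> l) + d (\<phi> l) h"
      by (intro triangle hom_closed p)
    also have "\<dots> \<le> 1 / 8 + 1 / 8" using z l commute[of h] commute[of "\<phi> (l + a - z)"] by (simp add: d_hom)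
    finally have "h' \<in> C" using z h' hom_closed by (auto simp: C_def)
    moreover have "add h' (\<phi> (l + a)) = h"
      unfolding h'_def using p hom_closed neg_closed
      by (simp add: add_assoc add_neg) (metis add_commute add_unit add_neg add_closed)
    moreover have "k + (l + a) = g" using a(3) by (simp add: algebra_simps)
    ultimately show "p \<in> {(fst k + fst l, add (snd k) (snd l)) | k l. k \<in> K \<times> C \<and> l \<in> ?L}"
      using a p by (intro CollectI exI[of _ "(k, h')"] exI[of _ "(l + a, \<phi> (l + a))"]) auto
  qed
  ultimately have "\<exists>K. compactin (prod_topology euclidean mtopology) K \<and>
      {(fst k + fst l, add (snd k) (snd l)) | k l. k \<in> K \<and> l \<in> ?L} = UNIV \<times> topspace mtopology"
    by (intro exI[of _ "K \<times> C"] conjI)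
  moreover have "mtopology closure_of (snd ` ?L) = M"
    using hom_dense hom_closed by (force simp: metric_closure_of)
  ultimately show ?thesis
    unfolding cut_and_project_def
    using lca_group_mtopology graph_discrete[OF lc] hom_closed
    by (intro conjI) (auto simp: inj_on_def image_iff hom_zero hom_add hom_neg)
qed

lemma star_graph: "star (range (\<lambda>x. (x, \<phi> x))) x = \<phi> x"
proof -
  have "the_inv_into (range (\<lambda>x. (x, \<phi> x))) fst x = (x, \<phi> x)"
    by (rule the_inv_into_f_eq) (auto simp: inj_on_def)
  then show ?thesis by (simp add: star_def)
qed

text \<open>Finitely many compact balls around the images of a net of \<Lambda> contain the image of
  \<Lambda>. Since \<Lambda> is nonempty, there is at least one ball, which supplies the
  interior.\<close>

lemma admissible_window_exists:
  assumes "finite Z" "\<And>a. a \<in> \<Lambda> \<Longrightarrow> \<exists>z\<in>Z. N (a - z) \<le> 1 / 8" "\<Lambda> \<noteq> {}"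
  obtains W where "admissible_window mtopology W" "\<Lambda> \<subseteq> model_set (range (\<lambda>x. (x, \<phi> x))) W"
proof
  let ?W = "\<Union>z\<in>Z. mcball (\<phi> z) (1 / 4)"
  obtain z where z: "z \<in> Z" using assms by blast
  have compact_W: "compactin mtopology ?W"
    using assms(1) by (intro compactin_Union) (auto intro: compactin_mcball hom_closed)
  then have closure_W: "mtopology closure_of ?W = ?W"
    by (intro closure_of_closedin compactin_imp_closedin Hausdorff_space_mtopology)
  have "mball (\<phi> z) (1 / 4) \<subseteq> mtopology interior_of ?W"
    using z by (intro interior_of_maximal) auto
  moreover have "\<phi> z \<in> mball (\<phi> z) (1 / 4)" using hom_closed by simp
  ultimately have "mtopology interior_of ?W \<noteq> {}" by blast
  then show "admissible_window mtopology ?W"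
    using compact_W closure_W by (auto simp: admissible_window_def)
  show "\<Lambda> \<subseteq> model_set (range (\<lambda>x. (x, \<phi> x))) ?W"
  proof
    fix a assume "a \<in> \<Lambda>"
    then obtain z where z: "z \<in> Z" "N (a - z) \<le> 1 / 8" using assms(2) by blast
    then have "d (\<phi> z) (\<phi> a) \<le> 1 / 4" using d_hom[of a z] commute[of "\<phi> z" "\<phi> a"] by linarith
    then show "a \<in> model_set (range (\<lambda>x. (x, \<phi> x))) ?W"
      using z hom_closed by (auto simp: model_set_def star_graph image_iff)
  qed
qed

end

section \<open>Completion\<close>

locale seminormed_group =
  fixes N :: "'a::ab_group_add \<Rightarrow> real"
  assumes seminorm: "group_seminorm N"
begin

text \<open>The Kuratowski embedding. Elements at seminorm distance 0 get the same function, so the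
  quotient by the kernel of \<open>N\<close> needs no separate construction.\<close>

definition pt :: "'a \<Rightarrow> 'a \<Rightarrow> real" where
  "pt x y = N (x - y)"

definition near :: "real \<Rightarrow> ('a \<Rightarrow> real) \<Rightarrow> ('a \<Rightarrow> real) \<Rightarrow> bool" where
  "near e f g \<longleftrightarrow> (\<forall>y. \<bar>f y - g y\<bar> \<le> e)"

text \<open>A point \<open>h\<close> of the completion is represented by its distance function \<open>y \<mapsto> d(h, y)\<close>
  on the group; in these terms the sum of two points is an infimal convolution.\<close>

definition compl :: "('a \<Rightarrow> real) set" where
  "compl = {f. \<forall>e>0. \<exists>x. near e f (pt x)}"

definition conv :: "('a \<Rightarrow> real) \<Rightarrow> ('a \<Rightarrow> real) \<Rightarrow> 'a \<Rightarrow> real" where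
  "conv f g y = (INF z. f z + g (y - z))"

definition reflect :: "('a \<Rightarrow> real) \<Rightarrow> 'a \<Rightarrow> real" where
  "reflect f y = f (- y)"

text \<open>The value 0 off \<open>compl\<close> is there because a metric space structure demands
  nonnegativity and symmetry for all arguments, where a supremum of an unbounded set would be
  uncontrolled.\<close>

definition sup_dist :: "('a \<Rightarrow> real) \<Rightarrow> ('a \<Rightarrow> real) \<Rightarrow> real" where
  "sup_dist f g = (if f \<in> compl \<and> g \<in> compl then SUP y. \<bar>f y - g y\<bar> else 0)"

lemma N_zero: "N 0 = 0" and N_nonneg: "0 \<le> N x" and N_minus: "N (- x) = N x"
  and N_add: "N (x + y) \<le> N x + N y"
  using seminorm by (auto simp: group_seminorm_def)

lemma N_commute: "N (x - y) = N (y - x)"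
  using N_minus[of "x - y"] by simp

lemma N_triangle: "N (x - z) \<le> N (x - y) + N (y - z)"
  using N_add[of "x - y" "y - z"] by simp

lemma near_sym: "near e f g \<Longrightarrow> near e g f"
  by (simp add: near_def abs_minus_commute)

lemma near_trans:
  assumes "near a f g" "near b g h" "a + b \<le> c"
  shows "near c f h"
  unfolding near_def
proof
  fix y
  have "\<bar>f y - g y\<bar> \<le> a" "\<bar>g y - h y\<bar> \<le> b" using assms by (auto simp: near_def)
  then show "\<bar>f y - h y\<bar> \<le> c" using assms(3) by linarith
qed

lemma near_mono: "near a f g \<Longrightarrow> a \<le> b \<Longrightarrow> near b f g"
  unfolding near_def by (meson order_trans)

lemma near_imp_eq:
  assumes "\<And>e. e > 0 \<Longrightarrow> near e f g"
  shows "f = g"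
proof
  fix y
  have "\<bar>f y - g y\<bar> \<le> 0"
  proof (rule field_le_epsilon)
    fix e :: real assume "e > 0"
    from assms[OF this] show "\<bar>f y - g y\<bar> \<le> 0 + e" by (simp add: near_def)
  qed
  then show "f y = g y" by simp
qed

lemma near_pt: "near (N (x - y)) (pt x) (pt y)"
  unfolding near_def pt_def
proof
  fix z
  show "\<bar>N (x - z) - N (y - z)\<bar> \<le> N (x - y)"
    using N_triangle[of x z y] N_triangle[of y z x] N_commute[of x y] by linarith
qed

lemma complE:
  assumes "f \<in> compl" "e > 0"
  obtains x where "near e f (pt x)"
  using assms by (auto simp: compl_def)

lemma pt_compl: "pt x \<in> compl"
  by (auto simp: compl_def near_def intro!: exI[of _ x])

lemma compl_nonneg:
  assumes "f \<in> compl"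
  shows "0 \<le> f y"
proof (rule field_le_epsilon)
  fix e :: real assume "e > 0"
  then obtain x where "near e f (pt x)" using assms complE by blast
  then have "\<bar>f y - pt x y\<bar> \<le> e" by (simp add: near_def)
  then show "0 \<le> f y + e" using N_nonneg[of "x - y"] by (simp add: pt_def)
qed

text \<open>The value \<open>f y\<close> bounds the distance from \<open>f\<close> to the point
  \<open>pt y\<close>: for group elements this is the reverse triangle inequality, and it passes to
  uniform limits.\<close>

lemma near_pt_self:
  assumes "f \<in> compl"
  shows "near (f y) f (pt y)"
  unfolding near_def
proof
  fix z
  show "\<bar>f z - pt y z\<bar> \<le> f y"
  proof (rule field_le_epsilon)
    fix e :: real assume "e > 0"
    then obtain x where "near (e / 2) f (pt x)" using assms complE[of f "e / 2"] by auto
    then have "\<bar>f z - pt x z\<bar> \<le> e / 2" "\<bar>f y - pt x y\<bar> \<le> e / 2" by (auto simp: near_def)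
    moreover have "\<bar>pt x z - pt y z\<bar> \<le> pt x y" using near_pt[of x y] by (simp add: near_def pt_def)
    ultimately show "\<bar>f z - pt y z\<bar> \<le> f y + e" by linarith
  qed
qed

section \<open>Group law on distance functions\<close>

lemma conv_le:
  assumes "f \<in> compl" "g \<in> compl"
  shows "conv f g y \<le> f z + g (y - z)"
  unfolding conv_def
proof (rule cINF_lower)
  show "bdd_below (range (\<lambda>z. f z + g (y - z)))"
    using compl_nonneg assms by (intro bdd_belowI[of _ 0]) (auto intro: add_nonneg_nonneg)
qed simp

lemma conv_ge: "(\<And>z. c \<le> f z + g (y - z)) \<Longrightarrow> c \<le> conv f g y"
  unfolding conv_def by (rule cINF_greatest) auto

lemma near_conv:
  assumes "f \<in> compl" "g \<in> compl" "f' \<in> compl" "g' \<in> compl" "near a f f'" "near b g g'"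
  shows "near (a + b) (conv f g) (conv f' g')"
proof -
  have le: "conv f g y - (a + b) \<le> conv f' g' y"
    if "f \<in> compl" "g \<in> compl" "near a f f'" "near b g g'" for f g f' g' y
  proof (rule conv_ge)
    fix z
    have "\<bar>f z - f' z\<bar> \<le> a" "\<bar>g (y - z) - g' (y - z)\<bar> \<le> b" using that by (auto simp: near_def)
    then show "conv f g y - (a + b) \<le> f' z + g' (y - z)" using conv_le[OF that(1,2), of y z] by linarith
  qed
  show ?thesis
    unfolding near_def
  proof
    fix y
    show "\<bar>conv f g y - conv f' g' y\<bar> \<le> a + b"
      using le[OF assms(1,2,5,6), of y] le[OF assms(3,4) near_sym[OF assms(5)] near_sym[OF assms(6)], of y]
      by linarith
  qed
qed

text \<open>The infimum is attained at \<open>z = x\<close>; the lower bound is subadditivity of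
  \<open>N\<close>. This makes \<open>pt\<close> a homomorphism for \<open>conv\<close>.\<close>

lemma conv_pt: "conv (pt x) (pt y) = pt (x + y)"
proof
  fix w
  have "conv (pt x) (pt y) w \<le> pt (x + y) w"
    using conv_le[OF pt_compl pt_compl, of x y w x] by (simp add: pt_def N_zero algebra_simps)
  moreover have "pt (x + y) w \<le> conv (pt x) (pt y) w"
  proof (rule conv_ge)
    fix z
    show "pt (x + y) w \<le> pt x z + pt y (w - z)"
      using N_add[of "x - z" "y - (w - z)"] by (simp add: pt_def algebra_simps)
  qed
  ultimately show "conv (pt x) (pt y) w = pt (x + y) w" by simp
qed

lemma near_reflect: "near e f g \<Longrightarrow> near e (reflect f) (reflect g)"
  by (simp add: near_def reflect_def)

lemma reflect_pt: "reflect (pt x) = pt (- x)"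
proof
  fix y
  show "reflect (pt x) y = pt (- x) y"
    using N_minus[of "x + y"] by (simp add: reflect_def pt_def algebra_simps)
qed

lemma reflect_compl:
  assumes "f \<in> compl"
  shows "reflect f \<in> compl"
  unfolding compl_def
proof (intro CollectI allI impI)
  fix e :: real assume "e > 0"
  then obtain x where "near e f (pt x)" using assms complE by blast
  then show "\<exists>x. near e (reflect f) (pt x)" using near_reflect reflect_pt by metis
qed

lemma conv_compl:
  assumes "f \<in> compl" "g \<in> compl"
  shows "conv f g \<in> compl"
  unfolding compl_def
proof (intro CollectI allI impI)
  fix e :: real assume e: "e > 0"
  obtain x where x: "near (e / 2) f (pt x)" using assms(1) e complE[of f "e / 2"] by auto
  obtain y where y: "near (e / 2) g (pt y)" using assms(2) e complE[of g "e / 2"] by auto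
  show "\<exists>x. near e (conv f g) (pt x)"
    using near_conv[OF assms pt_compl pt_compl x y] by (auto simp: conv_pt)
qed

text \<open>The identity holds on the dense image of \<open>pt\<close>, and \<open>near_conv\<close>
  bounds the error of replacing each argument by a nearby group element. The remaining group laws
  follow the same scheme.\<close>

lemma conv_commute:
  assumes f: "f \<in> compl" and g: "g \<in> compl"
  shows "conv f g = conv g f"
proof (rule near_imp_eq)
  fix e :: real assume e: "e > 0"
  obtain x where x: "near (e / 4) f (pt x)" using f e complE[of f "e / 4"] by auto
  obtain y where y: "near (e / 4) g (pt y)" using g e complE[of g "e / 4"] by auto
  note n1 = near_conv[OF f g pt_compl pt_compl x y] and n2 = near_conv[OF g f pt_compl pt_compl y x]
  show "near e (conv f g) (conv g f)"
    using near_trans[OF n1 near_sym[OF n2[unfolded conv_pt add.commute[of y x], folded conv_pt]]] by simp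
qed

lemma conv_assoc:
  assumes f: "f \<in> compl" and g: "g \<in> compl" and h: "h \<in> compl"
  shows "conv (conv f g) h = conv f (conv g h)"
proof (rule near_imp_eq)
  fix e :: real assume e: "e > 0"
  obtain x where x: "near (e / 6) f (pt x)" using f e complE[of f "e / 6"] by auto
  obtain y where y: "near (e / 6) g (pt y)" using g e complE[of g "e / 6"] by auto
  obtain z where z: "near (e / 6) h (pt z)" using h e complE[of h "e / 6"] by auto
  have n1: "near (e / 6 + e / 6 + e / 6) (conv (conv f g) h) (pt (x + y + z))"
    unfolding conv_pt[symmetric]
    by (intro near_conv conv_compl pt_compl f g h x y z)
  have n2: "near (e / 6 + (e / 6 + e / 6)) (conv f (conv g h)) (pt (x + (y + z)))"
    unfolding conv_pt[symmetric]
    by (intro near_conv conv_compl pt_compl f g h x y z)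
  show "near e (conv (conv f g) h) (conv f (conv g h))"
    by (rule near_trans[OF n1 near_sym[OF n2[folded add.assoc]]]) simp
qed

lemma conv_unit:
  assumes f: "f \<in> compl"
  shows "conv (pt 0) f = f"
proof (rule near_imp_eq)
  fix e :: real assume e: "e > 0"
  obtain x where x: "near (e / 2) f (pt x)" using f e complE[of f "e / 2"] by auto
  have n0: "near 0 (pt 0) (pt 0)" by (simp add: near_def)
  have n1: "near (0 + e / 2) (conv (pt 0) f) (pt (0 + x))"
    unfolding conv_pt[symmetric] by (intro near_conv pt_compl f x n0)
  show "near e (conv (pt 0) f) f"
    by (rule near_trans[OF n1[unfolded add_0] near_sym[OF x]]) simp
qed

lemma conv_reflect:
  assumes f: "f \<in> compl"
  shows "conv (reflect f) f = pt 0"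
proof (rule near_imp_eq)
  fix e :: real assume e: "e > 0"
  obtain x where x: "near (e / 2) f (pt x)" using f e complE[of f "e / 2"] by auto
  have "near (e / 2 + e / 2) (conv (reflect f) f) (pt (- x + x))"
    unfolding conv_pt[symmetric] reflect_pt[symmetric]
    by (intro near_conv pt_compl reflect_compl near_reflect f x)
  then show "near e (conv (reflect f) f) (pt 0)" by simp
qed

section \<open>Sup distance and completeness\<close>

lemma near_compl_exists:
  assumes "f \<in> compl" "g \<in> compl"
  shows "near (f 0 + g 0) f g"
  using near_trans[OF near_pt_self[OF assms(1), of 0] near_sym[OF near_pt_self[OF assms(2), of 0]]] by simp

lemma sup_dist_le_iff:
  assumes "f \<in> compl" "g \<in> compl"
  shows "sup_dist f g \<le> e \<longleftrightarrow> near e f g"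
proof -
  have "bdd_above (range (\<lambda>y. \<bar>f y - g y\<bar>))"
    using near_compl_exists[OF assms] by (intro bdd_aboveI) (auto simp: near_def)
  then show ?thesis
    using assms by (simp add: sup_dist_def cSUP_le_iff near_def)
qed

lemma near_sup_dist: "f \<in> compl \<Longrightarrow> g \<in> compl \<Longrightarrow> near (sup_dist f g) f g"
  using sup_dist_le_iff by blast

lemma sup_dist_pt: "sup_dist (pt x) (pt y) = N (x - y)"
proof (rule antisym)
  show "sup_dist (pt x) (pt y) \<le> N (x - y)"
    by (simp add: sup_dist_le_iff pt_compl near_pt)
  have "\<bar>pt x y - pt y y\<bar> \<le> sup_dist (pt x) (pt y)"
    using near_sup_dist[OF pt_compl pt_compl, of x y] by (simp add: near_def)
  then show "N (x - y) \<le> sup_dist (pt x) (pt y)" by (simp add: pt_def N_zero)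
qed

lemma sup_dist_nonneg: "0 \<le> sup_dist f g"
proof (cases "f \<in> compl \<and> g \<in> compl")
  case True
  then have "\<bar>f 0 - g 0\<bar> \<le> sup_dist f g" using near_sup_dist by (simp add: near_def)
  then show ?thesis by linarith
qed (auto simp: sup_dist_def)

lemma sup_dist_commute: "sup_dist f g = sup_dist g f"
  by (simp add: sup_dist_def abs_minus_commute conj_commute)

lemma Metric_space_compl: "Metric_space compl sup_dist"
proof
  show "0 \<le> sup_dist f g" for f g by (rule sup_dist_nonneg)
  show "sup_dist f g = sup_dist g f" for f g by (rule sup_dist_commute)
  show "sup_dist f g = 0 \<longleftrightarrow> f = g" if "f \<in> compl" "g \<in> compl" for f g
  proof
    assume "sup_dist f g = 0"
    then have "near 0 f g" using near_sup_dist[OF that] by simp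
    then show "f = g" by (intro near_imp_eq) (auto intro: near_mono)
  next
    assume "f = g"
    then have "sup_dist f g \<le> 0" using sup_dist_le_iff[OF that] by (simp add: near_def)
    then show "sup_dist f g = 0" using sup_dist_nonneg[of f g] by simp
  qed
  show "sup_dist f h \<le> sup_dist f g + sup_dist g h" if "f \<in> compl" "g \<in> compl" "h \<in> compl" for f g h
    unfolding sup_dist_le_iff[OF that(1,3)]
    by (rule near_trans[OF near_sup_dist[OF that(1,2)] near_sup_dist[OF that(2,3)] order_refl])
qed

lemma compl_Cauchy_convergent:
  fixes \<sigma> :: "nat \<Rightarrow> 'a \<Rightarrow> real"
  assumes \<sigma>: "\<And>n. \<sigma> n \<in> compl"
    and cauchy: "\<And>e. e > 0 \<Longrightarrow> \<exists>k. \<forall>m\<ge>k. \<forall>n\<ge>k. near e (\<sigma> m) (\<sigma> n)"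
  obtains f where "f \<in> compl" "\<And>e. e > 0 \<Longrightarrow> \<exists>k. \<forall>n\<ge>k. near e (\<sigma> n) f"
proof -
  have "Cauchy (\<lambda>n. \<sigma> n y)" for y
    unfolding Cauchy_def
  proof (intro allI impI)
    fix e :: real assume "e > 0"
    then obtain k where k: "\<forall>m\<ge>k. \<forall>n\<ge>k. near (e / 2) (\<sigma> m) (\<sigma> n)" using cauchy[of "e / 2"] by auto
    have "dist (\<sigma> m y) (\<sigma> n y) < e" if "m \<ge> k" "n \<ge> k" for m n
    proof -
      have "\<bar>\<sigma> m y - \<sigma> n y\<bar> \<le> e / 2" using k that by (auto simp: near_def)
      then show ?thesis using \<open>e > 0\<close> by (simp add: dist_real_def)
    qed
    then show "\<exists>M. \<forall>m\<ge>M. \<forall>n\<ge>M. dist (\<sigma> m y) (\<sigma> n y) < e" by blast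
  qed
  then have "\<exists>l. (\<lambda>n. \<sigma> n y) \<longlonglongrightarrow> l" for y
    by (simp add: Cauchy_convergent_iff convergent_def)
  then obtain f where f: "\<And>y. (\<lambda>n. \<sigma> n y) \<longlonglongrightarrow> f y" by metis
  have lim: "\<exists>k. \<forall>n\<ge>k. near e (\<sigma> n) f" if e: "e > 0" for e
  proof -
    obtain k where k: "\<forall>m\<ge>k. \<forall>n\<ge>k. near e (\<sigma> m) (\<sigma> n)" using cauchy[OF e] by blast
    have "\<bar>\<sigma> n y - f y\<bar> \<le> e" if "n \<ge> k" for n y
    proof (rule LIMSEQ_le_const2)
      show "(\<lambda>m. \<bar>\<sigma> n y - \<sigma> m y\<bar>) \<longlonglongrightarrow> \<bar>\<sigma> n y - f y\<bar>"
        by (intro tendsto_intros f)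
      show "\<exists>M. \<forall>m\<ge>M. \<bar>\<sigma> n y - \<sigma> m y\<bar> \<le> e" using k that by (auto simp: near_def)
    qed
    then show ?thesis by (auto simp: near_def)
  qed
  have "f \<in> compl"
    unfolding compl_def
  proof (intro CollectI allI impI)
    fix e :: real assume "e > 0"
    then obtain n where n: "near (e / 2) (\<sigma> n) f" using lim[of "e / 2"] by auto
    obtain x where x: "near (e / 2) (\<sigma> n) (pt x)" using \<open>e > 0\<close> \<sigma> complE[of "\<sigma> n" "e / 2"] by auto
    show "\<exists>x. near e f (pt x)" using near_trans[OF near_sym[OF n] x] by auto
  qed
  then show thesis using lim that by blast
qed

text \<open>The sublevel sets of the distance function determine a point, which lets the completion live
  on the type \<open>'a set set\<close>.\<close>

definition code :: "('a \<Rightarrow> real) \<Rightarrow> 'a set set" where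
  "code f = {{y. f y < r} | r. r > 0}"

text \<open>A common sublevel set contains a point \<open>y\<close> at which \<open>f\<close> and
  \<open>g\<close> are both at most \<open>e / 2\<close>, so both functions are that close to
  \<open>pt y\<close>. Taking \<open>s < r\<close> puts \<open>y\<close> into the sublevel set, and
  \<open>s \<le> e / 2\<close> bounds \<open>g y\<close>.\<close>

lemma inj_on_code: "inj_on code compl"
proof (rule inj_onI, rule near_imp_eq)
  fix f g and e :: real assume f: "f \<in> compl" and g: "g \<in> compl" and eq: "code f = code g" and e: "e > 0"
  have "{y. f y < e / 2} \<in> code f" unfolding code_def using half_gt_zero[OF e] by blast
  then have "{y. f y < e / 2} \<in> code g" by (simp only: eq)
  then obtain r where r: "r > 0" "{y. f y < e / 2} = {y. g y < r}" by (auto simp: code_def)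
  define s where "s = min (r / 2) (e / 2)"
  have s: "s > 0" "s < r" "s \<le> e / 2" using r e by (auto simp: s_def)
  obtain y where "near s g (pt y)" using complE[OF g s(1)] by blast
  then have "\<bar>g y - pt y y\<bar> \<le> s" by (simp add: near_def)
  then have "g y \<le> s" by (simp add: pt_def N_zero)
  moreover from this have "y \<in> {y. g y < r}" using s(2) by simp
  then have "f y < e / 2" unfolding r(2)[symmetric] by simp
  ultimately show "near e f g"
    using s(3) by (intro near_trans[OF near_pt_self[OF f, of y] near_sym[OF near_pt_self[OF g, of y]]]) linarith
qed

definition decode :: "'a set set \<Rightarrow> 'a \<Rightarrow> real" where
  "decode = inv_into compl code"

lemma decode_code: "f \<in> compl \<Longrightarrow> decode (code f) = f"
  by (simp add: decode_def inv_into_f_f[OF inj_on_code])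

lemma decode_compl: "p \<in> code ` compl \<Longrightarrow> decode p \<in> compl"
  by (auto simp: decode_code)

lemma code_decode: "p \<in> code ` compl \<Longrightarrow> code (decode p) = p"
  by (auto simp: decode_code)

definition code_dist :: "'a set set \<Rightarrow> 'a set set \<Rightarrow> real" where
  "code_dist p q = sup_dist (decode p) (decode q)"

lemma Metric_space_code: "Metric_space (code ` compl) code_dist"
proof -
  interpret Metric_space compl sup_dist by (rule Metric_space_compl)
  show ?thesis
  proof
    show "0 \<le> code_dist p q" "code_dist p q = code_dist q p" for p q
      by (simp_all add: code_dist_def commute)
    show "code_dist p q = 0 \<longleftrightarrow> p = q" if "p \<in> code ` compl" "q \<in> code ` compl" for p q
      using that by (auto simp: code_dist_def decode_code)
    show "code_dist p r \<le> code_dist p q + code_dist q r"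
      if "p \<in> code ` compl" "q \<in> code ` compl" "r \<in> code ` compl" for p q r
      unfolding code_dist_def using that by (intro triangle decode_compl)
  qed
qed

lemma mcomplete_code: "Metric_space.mcomplete (code ` compl) code_dist"
proof -
  interpret C: Metric_space "code ` compl" code_dist by (rule Metric_space_code)
  show ?thesis
    unfolding C.mcomplete_def
  proof (intro allI impI)
    fix \<sigma> assume "C.MCauchy \<sigma>"
    then have \<sigma>: "\<sigma> n \<in> code ` compl" and cauchy: "e > 0 \<Longrightarrow> \<exists>k. \<forall>m n. k \<le> m \<longrightarrow> k \<le> n \<longrightarrow> code_dist (\<sigma> m) (\<sigma> n) < e" for n e
      by (auto simp: C.MCauchy_def)
    have dec: "decode (\<sigma> n) \<in> compl" for n using \<sigma> by (rule decode_compl)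
    have "\<exists>k. \<forall>m\<ge>k. \<forall>n\<ge>k. near e (decode (\<sigma> m)) (decode (\<sigma> n))" if e: "e > 0" for e
    proof -
      obtain k where k: "\<And>m n. k \<le> m \<Longrightarrow> k \<le> n \<Longrightarrow> code_dist (\<sigma> m) (\<sigma> n) < e" using cauchy[OF e] by blast
      show ?thesis
        using k unfolding code_dist_def sup_dist_le_iff[OF dec dec, symmetric] by (meson less_imp_le)
    qed
    then obtain f where f: "f \<in> compl" "\<And>e. e > 0 \<Longrightarrow> \<exists>k. \<forall>n\<ge>k. near e (decode (\<sigma> n)) f"
      using compl_Cauchy_convergent[of "\<lambda>n. decode (\<sigma> n)", OF dec] by blast
    have "limitin C.mtopology \<sigma> (code f) sequentially"
      unfolding C.limitin_metric eventually_sequentially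
    proof (intro conjI allI impI)
      show "code f \<in> code ` compl" using f by blast
      fix e :: real assume "e > 0"
      then obtain k where k: "\<forall>n\<ge>k. near (e / 2) (decode (\<sigma> n)) f" using f(2)[of "e / 2"] by auto
      have "code_dist (\<sigma> n) (code f) < e" if "n \<ge> k" for n
      proof -
        have "code_dist (\<sigma> n) (code f) \<le> e / 2"
          unfolding code_dist_def decode_code[OF f(1)] sup_dist_le_iff[OF dec f(1)] using k that by blast
        then show ?thesis using \<open>e > 0\<close> by linarith
      qed
      then show "\<exists>k. \<forall>n\<ge>k. \<sigma> n \<in> code ` compl \<and> code_dist (\<sigma> n) (code f) < e" using \<sigma> by blast
    qed
    then show "\<exists>x. limitin C.mtopology \<sigma> x sequentially" by blast
  qed
qed

end

section \<open>Almost lattices\<close>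

text \<open>For differences \<open>u\<close> and \<open>v\<close>, the negative of \<open>v\<close>
  is again a difference, so \<open>u = x + f\<close> and \<open>- v = y + g\<close> with
  \<open>x\<close> and \<open>y\<close> in \<Lambda>. Then \<open>u + v = (x - y) + (f - g)\<close>,
  and \<open>F - F\<close> serves as the finite set.\<close>

lemma almost_lattice_approximate_subgroup:
  fixes \<Lambda> :: "'a::{topological_space, ab_group_add} set"
  assumes "\<Lambda> \<noteq> {}" "finite F" "{x - y | x y. x \<in> \<Lambda> \<and> y \<in> \<Lambda>} \<subseteq> {x + f | x f. x \<in> \<Lambda> \<and> f \<in> F}"
  shows "approximate_subgroup {x - y | x y. x \<in> \<Lambda> \<and> y \<in> \<Lambda>}" (is "approximate_subgroup ?A")
  unfolding approximate_subgroup_def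
proof (intro conjI ballI exI)
  obtain a where "a \<in> \<Lambda>" using assms by blast
  then show "0 \<in> ?A" by (intro CollectI exI[of _ a]) simp
  show "- x \<in> ?A" if x: "x \<in> ?A" for x
  proof -
    obtain u v where "u \<in> \<Lambda>" "v \<in> \<Lambda>" "x = u - v" using x by blast
    then show ?thesis by (intro CollectI exI[of _ v] exI[of _ u]) simp
  qed
  define F2 where "F2 = (\<lambda>(f, g). f - g) ` (F \<times> F)"
  show "finite F2" using assms by (simp add: F2_def)
  show "?A + ?A \<subseteq> ?A + F2"
  proof
    fix t assume "t \<in> ?A + ?A"
    then obtain u v where uv: "u \<in> ?A" "v \<in> ?A" "t = u + v" by (elim set_plus_elim)
    obtain x f where x: "x \<in> \<Lambda>" "f \<in> F" "u = x + f" using subsetD[OF assms(3) uv(1)] by blast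
    obtain p q where pq: "p \<in> \<Lambda>" "q \<in> \<Lambda>" "v = p - q" using uv(2) by blast
    have "q - p \<in> ?A" using pq by blast
    then obtain y g where y: "y \<in> \<Lambda>" "g \<in> F" "q - p = y + g" using subsetD[OF assms(3)] by blast
    have "v = - (y + g)" using pq(3) y(3) by (metis minus_diff_eq)
    then have "t = (x - y) + (f - g)" using uv x by (simp add: algebra_simps)
    moreover have "x - y \<in> ?A" "f - g \<in> F2" using x y by (auto simp: F2_def)
    ultimately show "t \<in> ?A + F2" by (simp only: set_plus_intro)
  qed
qed

lemma locally_finite_set_plus_finite:
  fixes \<Lambda> F :: "'a::topological_ab_group_add set"
  assumes "locally_finite_set \<Lambda>" "finite F"
  shows "locally_finite_set (\<Lambda> + F)"
  unfolding locally_finite_set_def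
proof (intro allI impI)
  fix K :: "'a set" assume K: "compact K"
  have "finite ((\<lambda>x. x + f) ` (\<Lambda> \<inter> (\<lambda>x. x - f) ` K))" for f
  proof -
    have "compact ((\<lambda>x. x - f) ` K)"
      by (intro compact_continuous_image K continuous_intros)
    then show ?thesis using assms(1) by (simp add: locally_finite_set_def)
  qed
  then have "finite (\<Union>f\<in>F. (\<lambda>x. x + f) ` (\<Lambda> \<inter> (\<lambda>x. x - f) ` K))"
    using assms(2) by blast
  moreover have "(\<Lambda> + F) \<inter> K \<subseteq> (\<Union>f\<in>F. (\<lambda>x. x + f) ` (\<Lambda> \<inter> (\<lambda>x. x - f) ` K))"
  proof
    fix k assume k: "k \<in> (\<Lambda> + F) \<inter> K"
    then obtain x f where xf: "x \<in> \<Lambda>" "f \<in> F" "k = x + f" by (auto elim: set_plus_elim)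
    have "x = k - f" using xf by simp
    then have "x \<in> (\<lambda>x. x - f) ` K" using k by blast
    then show "k \<in> (\<Union>f\<in>F. (\<lambda>x. x + f) ` (\<Lambda> \<inter> (\<lambda>x. x - f) ` K))" using xf by blast
  qed
  ultimately show "finite ((\<Lambda> + F) \<inter> K)" by (rule rev_finite_subset)
qed

lemma locally_finite_set_subset:
  "locally_finite_set B \<Longrightarrow> A \<subseteq> B \<Longrightarrow> locally_finite_set A"
  unfolding locally_finite_set_def by (meson Int_mono order_refl finite_subset)

text \<open>Everything is carried from \<open>A\<close> by finite translations: the ball lies in
  \<open>A + E\<close>, hence in \<Lambda> plus a finite set, and \<Lambda> lies in the translate of
  \<open>A\<close> by one of its own points \<open>c\<close>.\<close>

lemma almost_lattice_seminorm:
  fixes \<Lambda> :: "'a::topological_ab_group_add set"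
  assumes "almost_lattice \<Lambda>"
  obtains N where "group_seminorm N" "locally_finite_set {a. N a < 1 / 2}"
    "\<And>e. e > 0 \<Longrightarrow> \<exists>Z. finite Z \<and> (\<forall>a. N a < 1 / 2 \<longrightarrow> (\<exists>z\<in>Z. N (a - z) \<le> e))"
    "\<And>e. e > 0 \<Longrightarrow> \<exists>Z. finite Z \<and> (\<forall>a\<in>\<Lambda>. \<exists>z\<in>Z. N (a - z) \<le> e)"
proof -
  define A where "A = {x - y | x y. x \<in> \<Lambda> \<and> y \<in> \<Lambda>}"
  obtain F where F: "finite F" "A \<subseteq> {x + f | x f. x \<in> \<Lambda> \<and> f \<in> F}"
    using assms unfolding almost_lattice_def A_def by blast
  obtain c where c: "c \<in> \<Lambda>"
    using assms unfolding almost_lattice_def relatively_dense_def by blast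
  have approx: "approximate_subgroup A"
    unfolding A_def using F[unfolded A_def] c by (intro almost_lattice_approximate_subgroup[of \<Lambda> F]) auto
  obtain N where N: "group_seminorm N" "\<And>x. N x < 1 / 2 \<Longrightarrow> x \<in> A + A + A + A"
    "\<And>\<epsilon>. \<epsilon> > 0 \<Longrightarrow> \<exists>Z. finite Z \<and> (\<forall>a\<in>A. \<exists>z\<in>Z. N (a - z) \<le> \<epsilon>)"
    using approximate_subgroup_seminorm[OF approx] by blast
  obtain F' where F': "finite F'" "A + A \<subseteq> A + F'"
    using approx unfolding approximate_subgroup_def by blast
  define E where "E = F' + F' + F'"
  have E: "finite E" "A + A + A + A \<subseteq> A + E"
    unfolding E_def by (intro finite_set_plus F'(1)) (rule set_plus_quadruple_subset[OF F'(2)])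
  have ball: "N x < 1 / 2 \<Longrightarrow> x \<in> A + E" for x using N(2) E(2) by blast
  show thesis
  proof
    show "group_seminorm N" by (rule N)
    have A_sub: "A \<subseteq> \<Lambda> + F" using F(2) unfolding A_def set_plus_def by blast
    have "{a. N a < 1 / 2} \<subseteq> \<Lambda> + (F + E)"
    proof
      fix a assume "a \<in> {a. N a < 1 / 2}"
      then have "a \<in> A + E" using ball by simp
      then have "a \<in> \<Lambda> + F + E" by (rule subsetD[OF set_plus_mono2[OF A_sub order_refl]])
      then show "a \<in> \<Lambda> + (F + E)" by (simp only: add.assoc)
    qed
    moreover have "locally_finite_set (\<Lambda> + (F + E))"
      using assms F(1) E(1) unfolding almost_lattice_def
      by (intro locally_finite_set_plus_finite finite_set_plus) auto
    ultimately show "locally_finite_set {a. N a < 1 / 2}" by (rule locally_finite_set_subset[rotated])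
    fix e :: real assume "e > 0"
    then obtain Z where Z: "finite Z" and Z_cover: "\<forall>a\<in>A. \<exists>z\<in>Z. N (a - z) \<le> e"
      using N(3)[of e] by (elim meta_impE exE conjE)
    have "\<exists>w\<in>Z + E. N (a - w) \<le> e" if a: "N a < 1 / 2" for a
    proof -
      obtain b y where b: "b \<in> A" "y \<in> E" "a = b + y" using ball[OF a] by (elim set_plus_elim)
      obtain z where z: "z \<in> Z" "N (b - z) \<le> e" using bspec[OF Z_cover b(1)] by (elim bexE)
      have "z + y \<in> Z + E" "a - (z + y) = b - z" using b z by (auto intro: set_plus_intro)
      then show ?thesis using z(2) by (intro bexI[of _ "z + y"]) (simp_all only:)
    qed
    then show "\<exists>Z. finite Z \<and> (\<forall>a. N a < 1 / 2 \<longrightarrow> (\<exists>z\<in>Z. N (a - z) \<le> e))"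
      using finite_set_plus[OF Z E(1)] by (intro exI[of _ "Z + E"]) simp
    have "\<exists>w\<in>(+) c ` Z. N (a - w) \<le> e" if a: "a \<in> \<Lambda>" for a
    proof -
      have ac: "a - c \<in> A" unfolding A_def using a c by blast
      obtain z where z: "z \<in> Z" "N (a - c - z) \<le> e" using bspec[OF Z_cover ac] by (elim bexE)
      then show ?thesis by (intro bexI[of _ "c + z"]) (auto simp: diff_diff_eq)
    qed
    then show "\<exists>Z. finite Z \<and> (\<forall>a\<in>\<Lambda>. \<exists>z\<in>Z. N (a - z) \<le> e)"
      using Z by (intro exI[of _ "(+) c ` Z"]) simp
  qed
qed

lemma dense_metric_group_code:
  fixes N :: "'a::{topological_ab_group_add, t2_space} \<Rightarrow> real"
  assumes "group_seminorm N" "locally_finite_set {a. N a < 1 / 2}"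
    and cover: "\<And>e. e > 0 \<Longrightarrow> \<exists>Z. finite Z \<and> (\<forall>a. N a < 1 / 2 \<longrightarrow> (\<exists>z\<in>Z. N (a - z) \<le> e))"
  shows "\<exists>M d add unit neg (\<phi> :: 'a \<Rightarrow> 'a set set). dense_metric_group M d add unit neg \<phi> N"
proof -
  interpret seminormed_group N by standard (rule assms)
  define add where "add p q = code (conv (decode p) (decode q))" for p q
  define neg where "neg p = code (reflect (decode p))" for p
  define \<phi> where "\<phi> x = code (pt x)" for x
  interpret C: Metric_space "code ` compl" code_dist by (rule Metric_space_code)
  have "dense_metric_group (code ` compl) code_dist add (\<phi> 0) neg \<phi> N"
  proof
    show "C.mcomplete" by (rule mcomplete_code)
    show "add p q \<in> code ` compl" if "p \<in> code ` compl" "q \<in> code ` compl" for p q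
      unfolding add_def using that by (intro imageI conv_compl decode_compl)
    show "neg p \<in> code ` compl" if "p \<in> code ` compl" for p
      unfolding neg_def using that by (intro imageI reflect_compl decode_compl)
    show "add (add p q) r = add p (add q r)"
      if "p \<in> code ` compl" "q \<in> code ` compl" "r \<in> code ` compl" for p q r
      using that[THEN decode_compl] by (simp add: add_def decode_code conv_compl conv_assoc)
    show "add p q = add q p" if "p \<in> code ` compl" "q \<in> code ` compl" for p q
      using that[THEN decode_compl] by (simp add: add_def conv_commute)
    show "add (\<phi> 0) p = p" if "p \<in> code ` compl" for p
      using decode_compl[OF that] by (simp add: add_def \<phi>_def decode_code pt_compl conv_unit code_decode[OF that])
    show "add (neg p) p = \<phi> 0" if "p \<in> code ` compl" for p
      using decode_compl[OF that] by (simp add: add_def neg_def \<phi>_def decode_code reflect_compl conv_reflect)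
    show "code_dist (add p q) (add p' q') \<le> code_dist p p' + code_dist q q'"
      if "p \<in> code ` compl" "q \<in> code ` compl" "p' \<in> code ` compl" "q' \<in> code ` compl" for p q p' q'
      using that[THEN decode_compl]
      by (simp add: add_def code_dist_def decode_code conv_compl sup_dist_le_iff near_conv near_sup_dist)
    show "code_dist (neg p) (neg q) \<le> code_dist p q" if "p \<in> code ` compl" "q \<in> code ` compl" for p q
      using that[THEN decode_compl]
      by (simp add: neg_def code_dist_def decode_code reflect_compl sup_dist_le_iff near_reflect near_sup_dist)
    show "\<phi> x \<in> code ` compl" for x by (simp add: \<phi>_def pt_compl)
    show "\<phi> 0 = \<phi> 0" ..
    show "\<phi> (x + y) = add (\<phi> x) (\<phi> y)" for x y by (simp add: \<phi>_def add_def decode_code pt_compl conv_pt)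
    show "\<phi> (- x) = neg (\<phi> x)" for x by (simp add: \<phi>_def neg_def decode_code pt_compl reflect_pt)
    show "code_dist (\<phi> x) (\<phi> y) = N (x - y)" for x y
      by (simp add: \<phi>_def code_dist_def decode_code pt_compl sup_dist_pt)
    show "\<exists>g. code_dist p (\<phi> g) < e" if p: "p \<in> code ` compl" and e: "e > 0" for p e
    proof -
      obtain x where "near (e / 2) (decode p) (pt x)"
        using complE[OF decode_compl[OF p] half_gt_zero[OF e]] by blast
      then have "code_dist p (\<phi> x) \<le> e / 2"
        using decode_compl[OF p] by (simp only: \<phi>_def code_dist_def decode_code pt_compl sup_dist_le_iff)
      then show ?thesis using e by (intro exI[of _ x]) linarith
    qed
  qed (rule cover assms; assumption)+
  then show ?thesis by blast
qed

theorem theorem7p4: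
  fixes \<Lambda> :: "'a::{topological_ab_group_add, t2_space} set"
  assumes "locally_compact_space (euclidean :: 'a topology)"
    and "sigma_compact_group TYPE('a)"
    and "almost_lattice \<Lambda>"
  shows "\<exists>(T :: 'a set set topology) add zero neg (L :: ('a \<times> 'a set set) set) W.
           cut_and_project T add zero neg L \<and> admissible_window T W \<and>
           \<Lambda> \<subseteq> model_set L W"
proof -
  obtain N where N: "group_seminorm N" "locally_finite_set {a. N a < 1 / 2}"
    "\<And>e. e > 0 \<Longrightarrow> \<exists>Z. finite Z \<and> (\<forall>a. N a < 1 / 2 \<longrightarrow> (\<exists>z\<in>Z. N (a - z) \<le> e))"
    "\<And>e. e > 0 \<Longrightarrow> \<exists>Z. finite Z \<and> (\<forall>a\<in>\<Lambda>. \<exists>z\<in>Z. N (a - z) \<le> e)"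
    using almost_lattice_seminorm[OF assms(3)] by blast
  obtain M d add unit neg and \<phi> :: "'a \<Rightarrow> 'a set set"
    where "dense_metric_group M d add unit neg \<phi> N"
    using dense_metric_group_code[OF N(1-3)] by blast
  then interpret dense_metric_group M d add unit neg \<phi> N .
  \<comment> \<open>One net at scale 1/8 serves both cocompactness and the window.\<close>
  obtain Z where Z: "finite Z" "\<And>a. a \<in> \<Lambda> \<Longrightarrow> \<exists>z\<in>Z. N (a - z) \<le> 1 / 8"
    using N(4)[of "1/8"] by auto
  have dense: "relatively_dense \<Lambda>" and ne: "\<Lambda> \<noteq> {}"
    using assms(3) by (auto simp: almost_lattice_def relatively_dense_def)
  obtain W where "admissible_window mtopology W" "\<Lambda> \<subseteq> model_set (range (\<lambda>x. (x, \<phi> x))) W"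
    using admissible_window_exists[OF Z ne] by blast
  then show ?thesis using cut_and_project_graph[OF assms(1) dense Z] by blast
qed

end
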